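(* Let $\mathfrak{A}$ be a complex unital $C^*$-algebra and let $a\in\mathfrak{A}$ be a non-zero positive element. Let $k\ge 1$, let $x_1,\dots,x_k\in\mathfrak{A}_a$, and for each $j$ let $x_j^{\#_a}$ be an $a$-adjoint of $x_j$. Let $\mu\ge 0$ be real and let $(p_1,\dots,p_k)$ be a probability distribution, i.e. $p_j\ge 0$ for all $j$ and $\sum_{j=1}^k p_j=1$. Then \begin{align*} v_a^4\Big(\sum_{j=1}^k p_jx_j\Big)\le{}& \frac{1}{2(1+\mu)}v_a^2\Big(\sum_{j=1}^k p_jx_j^2\Big)+\frac{1+2\mu}{8(1+\mu)}\Big(\sum_{j=1}^k p_j\big\|x_j^{\#_a}x_j+x_jx_j^{\#_a}\big\|_a\Big)^2\\ &-\frac18 c_a^2\Big(\sum_{j=1}^k p_j\big(x_j^{\#_a}x_j-x_jx_j^{\#_a}\big)\Big). \end{align*}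
   Context: A linear functional $\varphi\in\mathfrak{A}^*$ is positive ($\varphi\ge0$) if $\varphi(x^*x)\ge 0$ for all $x\in\mathfrak{A}$. Set $\mathcal{S}_a(\mathfrak{A})=\{\varphi\in\mathfrak{A}^*:\varphi\ge 0,\ \varphi(a)=1\}$. For $x\in\mathfrak{A}$: the $a$-numerical range is $V_a(x)=\{\varphi(ax):\varphi\in\mathcal{S}_a(\mathfrak{A})\}$; the $a$-numerical radius is $v_a(x)=\sup\{|z|:z\in V_a(x)\}$; the $a$-Crawford number is $c_a(x)=\inf\{|z|:z\in V_a(x)\}$; and $\|x\|_a=\sup\{\sqrt{\varphi(x^*ax)}:\varphi\in\mathcal{S}_a(\mathfrak{A})\}$. An element $x^{\#_a}\in\mathfrak{A}$ is called an $a$-adjoint of $x\in\mathfrak{A}$ if $x^*a=ax^{\#_a}$ (it need not exist or be unique); $\mathfrak{A}_a$ is the set of all $x\in\mathfrak{A}$ that have an $a$-adjoint. Powers such as $v_a^4(x)$ and $c_a^2(x)$ mean $(v_a(x))^4$ and $(c_a(x))^2$. *)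

theory Defs
  imports "HOL-Analysis.Analysis"
begin

text \<open>
  Complex unital \<open>C\<^sup>*\<close>-algebras. The inherited law \<open>norm 1 = 1\<close> only excludes the zero algebra:
  in a non-zero unital \<open>C\<^sup>*\<close>-algebra it follows from the \<open>C\<^sup>*\<close>-identity.
\<close>

class unital_cstar_algebra = real_normed_algebra_1 + banach +
  fixes scaleC :: "complex \<Rightarrow> 'a \<Rightarrow> 'a"
    and star :: "'a \<Rightarrow> 'a"
  assumes scaleC_of_real: "scaleC (complex_of_real r) x = scaleR r x"
    and scaleC_add_right: "scaleC c (x + y) = scaleC c x + scaleC c y"
    and scaleC_add_left: "scaleC (c + d) x = scaleC c x + scaleC d x"
    and scaleC_scaleC: "scaleC c (scaleC d x) = scaleC (c * d) x"
    and mult_scaleC_left: "scaleC c x * y = scaleC c (x * y)"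
    and mult_scaleC_right: "x * scaleC c y = scaleC c (x * y)"
    and norm_scaleC: "norm (scaleC c x) = cmod c * norm x"
    and star_star: "star (star x) = x"
    and star_add: "star (x + y) = star x + star y"
    and star_scaleC: "star (scaleC c x) = scaleC (cnj c) (star x)"
    and star_mult: "star (x * y) = star y * star x"
    and cstar_identity: "norm (star x * x) = (norm x)\<^sup>2"

definition positive_element :: "'a::unital_cstar_algebra \<Rightarrow> bool" where
  "positive_element a \<longleftrightarrow> (\<exists>b. a = star b * b)"

definition dual_space :: "('a::unital_cstar_algebra \<Rightarrow> complex) set" where
  "dual_space = {\<phi>. bounded_linear \<phi> \<and> (\<forall>c x. \<phi> (scaleC c x) = c * \<phi> x)}"

definition positive_functional :: "('a::unital_cstar_algebra \<Rightarrow> complex) \<Rightarrow> bool" where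
  "positive_functional \<phi> \<longleftrightarrow> (\<forall>x. \<phi> (star x * x) \<in> \<real>\<^sub>\<ge>\<^sub>0)"

definition a_states :: "'a::unital_cstar_algebra \<Rightarrow> ('a \<Rightarrow> complex) set" where
  "a_states a = {\<phi> \<in> dual_space. positive_functional \<phi> \<and> \<phi> a = 1}"

definition a_numerical_range :: "'a::unital_cstar_algebra \<Rightarrow> 'a \<Rightarrow> complex set" where
  "a_numerical_range a x = {\<phi> (a * x) | \<phi>. \<phi> \<in> a_states a}"

text \<open>
  The suprema and infima below are taken in \<open>\<real>\<close>. If \<open>a\<close> is non-zero and positive there is at
  least one \<open>a\<close>-state, and if moreover \<open>x\<close> has an \<open>a\<close>-adjoint the sets are bounded, so that these
  are the true suprema and infima. For \<open>x\<close> without an \<open>a\<close>-adjoint the suprema may be infinite, and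
  then the real-valued \<open>Sup\<close> carries no information.
\<close>

definition a_numerical_radius :: "'a::unital_cstar_algebra \<Rightarrow> 'a \<Rightarrow> real" where
  "a_numerical_radius a x = (SUP z \<in> a_numerical_range a x. cmod z)"

definition a_crawford_number :: "'a::unital_cstar_algebra \<Rightarrow> 'a \<Rightarrow> real" where
  "a_crawford_number a x = (INF z \<in> a_numerical_range a x. cmod z)"

text \<open>For positive \<open>a\<close> the value \<open>\<phi> (star x * a * x)\<close> is a non-negative real, so \<open>Re\<close> loses nothing.\<close>

definition a_norm :: "'a::unital_cstar_algebra \<Rightarrow> 'a \<Rightarrow> real" where
  "a_norm a x = (SUP \<phi> \<in> a_states a. sqrt (Re (\<phi> (star x * a * x))))"

definition is_a_adjoint :: "'a::unital_cstar_algebra \<Rightarrow> 'a \<Rightarrow> 'a \<Rightarrow> bool" where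
  "is_a_adjoint a x y \<longleftrightarrow> star x * a = a * y"

definition a_adjointable :: "'a::unital_cstar_algebra \<Rightarrow> 'a set" where
  "a_adjointable a = {x. \<exists>y. is_a_adjoint a x y}"

end

theory Submission
  imports Defs "HOL-Real_Asymp.Real_Asymp"
begin

text \<open>
  For an \<open>a\<close>-state \<open>\<phi>\<close>, \<open>\<langle>u, v\<rangle> = \<phi> (star u * a * v)\<close> is a semi-inner product in which \<open>1\<close> is a unit
  vector and \<open>a\<close>-adjoints are adjoints. On the \<open>p\<close>-weighted direct sum of \<open>k\<close> copies, Buzano's
  inequality for \<open>(x\<^sub>j)\<close>, \<open>(x\<^sub>j')\<close> and the unit vector \<open>(1, \<dots>, 1)\<close> gives
  \<open>2 |\<phi> (a \<Sum>p\<^sub>jx\<^sub>j)|\<^sup>2 \<le> |\<phi> (a \<Sum>p\<^sub>jx\<^sub>j\<^sup>2)| + sqrt (P Q)\<close> with \<open>P = \<Sum>p\<^sub>j\<langle>x\<^sub>j, x\<^sub>j\<rangle>\<close> and \<open>Q = \<Sum>p\<^sub>j\<langle>x\<^sub>j', x\<^sub>j'\<rangle>\<close>;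
  squaring and \<open>4 P Q = (P + Q)\<^sup>2 - (P - Q)\<^sup>2\<close> yield the bound for each \<open>\<phi>\<close>.

  The supremum over \<open>\<phi>\<close> is meaningful only if some \<open>a\<close>-state exists. This follows from the Hahn-Banach
  theorem once elements \<open>star x * x\<close> are known to be positive in the sense \<open>norm (t - h) \<le> t\<close>, which is
  proved without spectral theory. The two tools are that for commuting selfadjoint \<open>r, s\<close> with \<open>r\<^sup>2 + s\<^sup>2 = t\<close>
  the element \<open>r + \<i> s\<close> has norm \<open>sqrt t\<close>, and that \<open>norm (k ^ n)\<close> determines \<open>norm k\<close> up to polynomial
  factors when \<open>k\<close> is selfadjoint.
\<close>

section \<open>The involution and powers of selfadjoint elements\<close>

lemma scaleC_minus_one: "scaleC (-1) x = - (x::'a::unital_cstar_algebra)"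
  using scaleC_of_real[of "-1" x] by simp

lemma scaleC_minus_left: "scaleC (- c) x = - scaleC c (x::'a::unital_cstar_algebra)"
  using scaleC_scaleC[of "-1" c x] by (simp add: scaleC_minus_one)

lemma bounded_linear_scaleC: "bounded_linear (scaleC c :: 'a::unital_cstar_algebra \<Rightarrow> 'a)"
proof (rule bounded_linear_intro)
  show "scaleC c (r *\<^sub>R x) = r *\<^sub>R scaleC c x" for r and x :: 'a
    by (simp flip: scaleC_of_real add: scaleC_scaleC mult.commute)
  show "norm (scaleC c x) \<le> norm x * cmod c" for x :: 'a
    by (simp add: norm_scaleC)
qed (rule scaleC_add_right)

lemma scaleC_ii_ii: "scaleC \<i> (scaleC \<i> x) = - (x::'a::unital_cstar_algebra)"
  by (simp add: scaleC_scaleC scaleC_minus_one)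

text \<open>The C*-identity gives \<open>norm y ^ 2 \<le> norm (star y) * norm y\<close>; equality
  comes from using this for both \<open>x\<close> and \<open>star x\<close>.\<close>

lemma norm_star: "norm (star x) = norm (x::'a::unital_cstar_algebra)"
proof -
  have "norm y \<le> norm (star y)" for y :: 'a
  proof (cases "y = 0")
    case False
    have "norm y * norm y \<le> norm (star y) * norm y"
      using norm_mult_ineq[of "star y" y] by (simp add: cstar_identity power2_eq_square)
    then show ?thesis using False by simp
  qed simp
  from this[of x] this[of "star x"] show ?thesis by (simp add: star_star)
qed

lemma star_scaleR: "star (r *\<^sub>R x) = r *\<^sub>R star (x::'a::unital_cstar_algebra)"
  by (simp flip: scaleC_of_real add: star_scaleC)

lemma bounded_linear_star: "bounded_linear (star :: 'a::unital_cstar_algebra \<Rightarrow> 'a)"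
  by (rule bounded_linear_intro[where K=1]) (auto simp: star_add star_scaleR norm_star)

lemmas star_zero = linear_simps(3)[OF bounded_linear_star]
  and star_diff = linear_simps(2)[OF bounded_linear_star]
  and star_minus = linear_simps(4)[OF bounded_linear_star]

lemma star_sum: "star (sum f I) = (\<Sum>i\<in>I. star (f i :: 'a::unital_cstar_algebra))"
  by (induction I rule: infinite_finite_induct) (auto simp: star_zero star_add)

lemma star_one: "star 1 = (1::'a::unital_cstar_algebra)"
  by (metis mult.left_neutral mult.right_neutral star_mult star_star)

lemma star_of_real: "star (of_real r) = (of_real r::'a::unital_cstar_algebra)"
  by (simp add: of_real_def star_scaleR star_one)

lemma star_power: "star (x ^ n) = star (x::'a::unital_cstar_algebra) ^ n"
  by (induction n) (auto simp: star_one star_mult power_commutes)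

lemmas star_simps = star_star star_add star_mult star_zero star_diff star_minus star_one
  star_of_real star_scaleR star_power star_scaleC

lemma of_real_commutes: "of_real r * x = x * (of_real r :: 'a::real_algebra_1)"
  by (simp add: of_real_def)

text \<open>Powers of \<open>h\<close> are selfadjoint, so by the C*-identity each doubling of the
  exponent squares the norm.\<close>

lemma norm_power_selfadjoint:
  fixes h :: "'a::unital_cstar_algebra"
  assumes "star h = h"
  shows "norm (h ^ (2 ^ n)) = norm h ^ (2 ^ n)"
proof (induction n)
  case (Suc n)
  have "norm (h ^ (2 ^ Suc n)) = norm (star (h ^ 2 ^ n) * h ^ 2 ^ n)"
    by (simp add: star_power assms mult_2 power_add)
  also have "\<dots> = norm h ^ (2 ^ Suc n)"
    by (simp add: cstar_identity Suc power_mult[symmetric] mult.commute)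
  finally show ?case .
qed simp

text \<open>If \<open>r > s > 0\<close>, the growth of \<open>(r / s) ^ n\<close> beats every linear
  factor. Together with the norm formula for powers this stands in for the spectral radius.\<close>

lemma le_if_two_powers_le:
  fixes r s c :: real
  assumes "r \<ge> 0" "s \<ge> 0" and le: "\<And>n. r ^ 2 ^ n \<le> (1 + c * 2 ^ n) * s ^ 2 ^ n"
  shows "r \<le> s"
proof (rule ccontr)
  assume "\<not> r \<le> s"
  then have "r > s" by simp
  show False
  proof (cases "s = 0")
    case True
    with le[of 0] \<open>r > s\<close> show False by simp
  next
    case False
    define q where "q = r / s"
    have q: "q > 1" using False assms \<open>r > s\<close> by (simp add: q_def)
    have "(\<lambda>n. (1 + c * real n) / q ^ n) \<longlonglongrightarrow> 0"
      using q by real_asymp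
    then have "\<forall>\<^sub>F n in sequentially. (1 + c * real n) / q ^ n < 1"
      by (rule order_tendstoD) simp
    then have "\<forall>\<^sub>F n in sequentially. (1 + c * real (2 ^ n)) / q ^ 2 ^ n < 1"
      by (rule eventually_compose_filterlim) (rule filterlim_subseq, simp add: strict_mono_def)
    then obtain n where "(1 + c * 2 ^ n) / q ^ 2 ^ n < 1"
      by (auto dest: eventually_happens)
    then have "1 + c * 2 ^ n < q ^ 2 ^ n" using q by (simp add: divide_less_eq)
    also have "\<dots> \<le> 1 + c * 2 ^ n"
      using le[of n] False assms(2) by (simp add: q_def power_divide divide_le_eq)
    finally show False by simp
  qed
qed

section \<open>Roots of selfadjoint elements from the binomial series\<close>

text \<open>For \<open>norm g < 1\<close> this plays the role of \<open>1 + g\<close> raised to the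
  real exponent \<open>\<alpha>\<close>.\<close>

definition binomial_series :: "real \<Rightarrow> 'a::{real_normed_algebra_1,banach} \<Rightarrow> 'a" where
  "binomial_series \<alpha> g = (\<Sum>n. (\<alpha> gchoose n) *\<^sub>R g ^ n)"

lemma summable_norm_binomial_series:
  fixes g :: "'a::{real_normed_algebra_1,banach}"
  assumes "norm g < 1"
  shows "summable (\<lambda>n. norm ((\<alpha> gchoose n) *\<^sub>R g ^ n))"
proof -
  have "summable (\<lambda>n. norm ((\<alpha> gchoose n) * norm g ^ n))"
    by (rule abs_summable_in_conv_radius) (use assms in \<open>auto simp: conv_radius_gchoose one_ereal_def\<close>)
  then have "summable (\<lambda>n. \<bar>\<alpha> gchoose n\<bar> * norm g ^ n)"
    by (simp add: abs_mult)
  then show ?thesis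
    by (rule summable_comparison_test') (auto intro!: mult_left_mono norm_power_ineq)
qed

text \<open>Vandermonde's identity evaluates the coefficients of the Cauchy product.\<close>

lemma binomial_series_add:
  fixes g :: "'a::{real_normed_algebra_1,banach}"
  assumes "norm g < 1"
  shows "binomial_series \<alpha> g * binomial_series \<beta> g = binomial_series (\<alpha> + \<beta>) g"
proof -
  have "(\<Sum>i\<le>k. ((\<alpha> gchoose i) *\<^sub>R g ^ i) * ((\<beta> gchoose (k - i)) *\<^sub>R g ^ (k - i)))
      = ((\<alpha> + \<beta>) gchoose k) *\<^sub>R g ^ k" for k
  proof -
    have "((\<alpha> gchoose i) *\<^sub>R g ^ i) * ((\<beta> gchoose (k - i)) *\<^sub>R g ^ (k - i))
        = ((\<alpha> gchoose i) * (\<beta> gchoose (k - i))) *\<^sub>R g ^ k" if "i \<le> k" for i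
      using that by (simp add: power_add[symmetric] mult.commute)
    then show ?thesis
      by (simp add: gbinomial_Vandermonde[symmetric] scaleR_sum_left[symmetric] atLeast0AtMost)
  qed
  then show ?thesis
    unfolding binomial_series_def
    using Cauchy_product[OF summable_norm_binomial_series[OF assms, of \<alpha>]
        summable_norm_binomial_series[OF assms, of \<beta>]] by simp
qed

lemma binomial_series_one: "binomial_series 1 g = 1 + g"
proof -
  have "(1 gchoose n :: real) = 0" if "n \<notin> {0, 1}" for n
    using that binomial_gbinomial[of 1 n, where ?'a = real] by (simp add: binomial_eq_0)
  then have "(\<lambda>n. (1 gchoose n :: real) *\<^sub>R g ^ n) sums (\<Sum>n\<in>{0,1}. (1 gchoose n :: real) *\<^sub>R g ^ n)"
    by (intro sums_finite) auto
  then show ?thesis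
    unfolding binomial_series_def by (simp add: sums_iff)
qed

lemma binomial_series_commutes:
  fixes g :: "'a::{real_normed_algebra_1,banach}"
  assumes "norm g < 1" "c * g = g * c"
  shows "c * binomial_series \<alpha> g = binomial_series \<alpha> g * c"
proof -
  note s = summable_norm_cancel[OF summable_norm_binomial_series[OF assms(1), of \<alpha>]]
  have "c * g ^ n = g ^ n * c" for n
    by (induction n) (auto simp: mult.assoc, metis assms(2) mult.assoc)
  then show ?thesis
    unfolding binomial_series_def suminf_mult[OF s, symmetric] suminf_mult2[OF s] by simp
qed

lemma star_binomial_series:
  fixes g :: "'a::unital_cstar_algebra"
  assumes "norm g < 1" "star g = g"
  shows "star (binomial_series \<alpha> g) = binomial_series \<alpha> g"
  unfolding binomial_series_def
  by (subst bounded_linear.suminf[OF bounded_linear_star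
        summable_norm_cancel[OF summable_norm_binomial_series[OF assms(1)]]])
     (simp add: star_simps assms)

text \<open>\<open>h\<close> is \<open>t\<close> times \<open>1 + g\<close> with
  \<open>norm g < 1\<close>, so the root is a power series in \<open>g\<close> and commutes with
  whatever commutes with \<open>h\<close>. A fourth root is taken so that the square root
  \<open>q ^ 2\<close> is itself the square of a selfadjoint element, hence positive.\<close>

lemma selfadjoint_fourth_root:
  fixes h :: "'a::unital_cstar_algebra"
  assumes h: "star h = h" and t: "norm (of_real t - h) < t"
  obtains q where "star q = q" "q ^ 4 = h" "\<And>c. c * h = h * c \<Longrightarrow> c * q = q * c"
proof -
  have "t > 0" using t norm_ge_zero[of "of_real t - h"] by linarith
  define g where "g = (1/t) *\<^sub>R h - 1"
  have "g = (-1/t) *\<^sub>R (of_real t - h)" using \<open>t > 0\<close>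
    by (simp add: g_def of_real_def algebra_simps)
  then have g: "norm g < 1" using t \<open>t > 0\<close> by simp
  define q where "q = root 4 t *\<^sub>R binomial_series (1/4) g"
  show ?thesis
  proof
    show "star q = q"
      unfolding q_def using g by (simp add: star_simps star_binomial_series g_def h)
    have "binomial_series (1/4) g ^ 4 = binomial_series 1 g"
      by (simp add: eval_nat_numeral mult.assoc binomial_series_add[OF g])
    then show "q ^ 4 = h"
      using \<open>t > 0\<close> by (simp add: q_def scaleR_power real_root_pow_pos2 binomial_series_one g_def)
    show "c * q = q * c" if "c * h = h * c" for c
      using binomial_series_commutes[OF g, of c] that
      by (simp add: q_def g_def algebra_simps)
  qed
qed

text \<open>For \<open>u = r + \<i> s\<close> commutation gives \<open>star u * u = t\<close>, and
  \<open>r\<close> is the real part of \<open>u\<close>, so its norm is at most that of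
  \<open>u\<close>.\<close>

lemma norm_le_of_commuting_sum_squares:
  fixes r s :: "'a::unital_cstar_algebra"
  assumes "star r = r" "star s = s" "r * s = s * r" "r\<^sup>2 + s\<^sup>2 = of_real t"
  shows "(norm r)\<^sup>2 \<le> \<bar>t\<bar>"
proof -
  define u where "u = r + scaleC \<i> s"
  have su: "star u = r - scaleC \<i> s"
    using assms scaleC_minus_one[of "scaleC \<i> s"] by (simp add: u_def star_simps scaleC_scaleC)
  have "star u * u = r\<^sup>2 + s\<^sup>2"
  proof -
    have "star u * u = r * r + scaleC \<i> (r * s) - scaleC \<i> (s * r) - scaleC \<i> (scaleC \<i> (s * s))"
      unfolding su
      by (simp add: u_def distrib_left left_diff_distrib mult_scaleC_left mult_scaleC_right scaleC_add_right
          linear_simps(2)[OF bounded_linear_scaleC])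
    then show ?thesis
      using assms by (simp add: scaleC_ii_ii power2_eq_square)
  qed
  then have "(norm u)\<^sup>2 = \<bar>t\<bar>"
    using cstar_identity[of u] assms by simp
  moreover have "r = (1/2) *\<^sub>R (u + star u)"
    unfolding su by (simp add: u_def flip: scaleR_2)
  then have "norm r \<le> norm u"
    using norm_triangle_ineq[of u "star u"] by (simp add: norm_star)
  then have "(norm r)\<^sup>2 \<le> (norm u)\<^sup>2" by (simp add: power_mono)
  ultimately show ?thesis by simp
qed

section \<open>Elements of the form \<open>star x * x\<close>\<close>

text \<open>For selfadjoint \<open>h\<close> the norm bound says that the spectrum lies between
  \<open>0\<close> and \<open>2 * t\<close>. In this form closure under sums is just the triangle
  inequality.\<close>

definition norm_positive :: "'a::unital_cstar_algebra \<Rightarrow> bool" where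
  "norm_positive h \<longleftrightarrow> star h = h \<and> (\<exists>t\<ge>0. norm (of_real t - h) \<le> t)"

lemma norm_positive_eventually:
  assumes "norm_positive h"
  obtains t where "t \<ge> 0" "\<And>s. s \<ge> t \<Longrightarrow> norm (of_real s - h) \<le> s"
proof -
  obtain t where t: "t \<ge> 0" "norm (of_real t - h) \<le> t"
    using assms by (auto simp: norm_positive_def)
  have "norm (of_real s - h) \<le> s" if "s \<ge> t" for s
  proof -
    have "of_real s - h = of_real (s - t) + (of_real t - h)" by simp
    then have "norm (of_real s - h) \<le> norm (of_real (s - t) :: 'a) + norm (of_real t - h)"
      by (metis norm_triangle_ineq)
    then show ?thesis using t that by (simp del: of_real_diff)
  qed
  with t show ?thesis using that by blast
qed

lemma norm_positive_add:
  assumes "norm_positive g" "norm_positive h"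
  shows "norm_positive (g + h)"
proof -
  obtain s t where "s \<ge> 0" "norm (of_real s - g) \<le> s" "t \<ge> 0" "norm (of_real t - h) \<le> t"
    using assms by (auto simp: norm_positive_def)
  moreover have "of_real (s + t) - (g + h) = (of_real s - g) + (of_real t - h)" by simp
  ultimately have "norm (of_real (s + t) - (g + h)) \<le> s + t"
    by (metis add_mono norm_triangle_le)
  then show ?thesis
    using assms \<open>s \<ge> 0\<close> \<open>t \<ge> 0\<close> unfolding norm_positive_def by (metis add_nonneg_nonneg star_add)
qed

lemma norm_positive_scaleR:
  assumes "norm_positive h" "c \<ge> 0"
  shows "norm_positive (c *\<^sub>R h)"
proof -
  obtain t where t: "t \<ge> 0" "norm (of_real t - h) \<le> t"
    using assms by (auto simp: norm_positive_def)
  have "of_real (c * t) - c *\<^sub>R h = c *\<^sub>R (of_real t - h)"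
    by (simp add: of_real_def algebra_simps)
  then have "norm (of_real (c * t) - c *\<^sub>R h) \<le> c * t"
    using t assms(2) by (simp add: mult_left_mono del: of_real_mult)
  then show ?thesis
    using assms t unfolding norm_positive_def by (metis mult_nonneg_nonneg star_scaleR)
qed

lemma norm_positive_norm_diff:
  assumes "star h = h" "norm h \<le> t"
  shows "norm_positive (of_real t - h)"
  unfolding norm_positive_def
  using assms norm_ge_zero[of h] by (intro conjI exI[of _ t]) (auto simp: star_simps simp del: norm_ge_zero)

text \<open>\<open>h\<close> commutes with a square root of \<open>t - h ^ 2\<close>, and the two
  squares add up to \<open>t\<close>. Hence the square of that root, which is
  \<open>t - h ^ 2\<close>, has norm at most \<open>t\<close>.\<close>

lemma norm_positive_square:
  assumes h: "star h = h"
  shows "norm_positive (h\<^sup>2)"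
proof -
  \<comment> \<open>The summand \<open>1\<close> supplies the strict inequality that the root
    requires.\<close>
  define t where "t = (norm h)\<^sup>2 + 1"
  have "norm (of_real t - (of_real t - h\<^sup>2)) < t"
    using norm_power_ineq[of h 2] by (simp add: t_def)
  then obtain q where q: "star q = q" "q ^ 4 = of_real t - h\<^sup>2"
      and comm: "\<And>c. c * (of_real t - h\<^sup>2) = (of_real t - h\<^sup>2) * c \<Longrightarrow> c * q = q * c"
    using selfadjoint_fourth_root[of "of_real t - h\<^sup>2" t] h by (auto simp: star_simps)
  have "h * q = q * h"
    by (rule comm) (simp add: algebra_simps of_real_commutes power2_eq_square)
  then have "q\<^sup>2 * h = h * q\<^sup>2"
    by (metis mult.assoc power2_eq_square)
  moreover have "(q\<^sup>2)\<^sup>2 = of_real t - h\<^sup>2" using q by simp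
  ultimately have "(norm (q\<^sup>2))\<^sup>2 \<le> \<bar>t\<bar>"
    using q h by (intro norm_le_of_commuting_sum_squares[of "q\<^sup>2" h]) (auto simp: star_simps)
  then have "norm ((q\<^sup>2)\<^sup>2) \<le> \<bar>t\<bar>"
    using norm_power_ineq[of "q\<^sup>2" 2] by linarith
  then show ?thesis
    using q h unfolding norm_positive_def
    by (intro conjI exI[of _ t]) (auto simp: star_simps t_def)
qed

text \<open>The shift by \<open>\<epsilon>\<close> turns the weak inequality in
  \<open>norm_positive\<close> into the strict one needed for convergence.\<close>

lemma norm_positive_fourth_root:
  assumes "norm_positive h" "\<epsilon> > 0"
  obtains q where "star q = q" "q ^ 4 = h + of_real \<epsilon>" "\<And>c. c * h = h * c \<Longrightarrow> c * q = q * c"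
proof -
  obtain t where t: "t \<ge> 0" "norm (of_real t - h) \<le> t" and h: "star h = h"
    using assms by (auto simp: norm_positive_def)
  have "norm (of_real (t + \<epsilon>) - (h + of_real \<epsilon>)) < t + \<epsilon>"
    using t assms(2) by simp
  then obtain q where "star q = q" "q ^ 4 = h + of_real \<epsilon>"
    "\<And>c. c * (h + of_real \<epsilon>) = (h + of_real \<epsilon>) * c \<Longrightarrow> c * q = q * c"
    using selfadjoint_fourth_root[of "h + of_real \<epsilon>" "t + \<epsilon>"] h by (auto simp: star_simps)
  then show ?thesis using that by (simp add: algebra_simps of_real_commutes)
qed

text \<open>Square roots of \<open>h + \<delta>\<close> and \<open>t - h + \<delta>\<close> commute
  and their squares add up to \<open>t + 2 * \<delta>\<close>, which bounds the norm of
  \<open>h + \<delta>\<close>.\<close>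

lemma norm_le_of_norm_positive:
  assumes h: "norm_positive h" and th: "norm_positive (of_real t - h)"
  shows "norm h \<le> \<bar>t\<bar>"
proof (rule field_le_epsilon)
  fix e :: real assume "e > 0"
  \<comment> \<open>Two shifts enlarge the sum of squares, and removing the shift from
    \<open>h\<close> costs a third.\<close>
  define \<delta> where "\<delta> = e / 3"
  have "\<delta> > 0" using \<open>e > 0\<close> by (simp add: \<delta>_def)
  obtain r where r: "star r = r" "r ^ 4 = h + of_real \<delta>" "\<And>c. c * h = h * c \<Longrightarrow> c * r = r * c"
    using norm_positive_fourth_root[OF h \<open>\<delta> > 0\<close>] by blast
  obtain s where s: "star s = s" "s ^ 4 = of_real t - h + of_real \<delta>"
      "\<And>c. c * (of_real t - h) = (of_real t - h) * c \<Longrightarrow> c * s = s * c"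
    using norm_positive_fourth_root[OF th \<open>\<delta> > 0\<close>] by blast
  have "h * s = s * h"
    by (rule s) (simp add: algebra_simps of_real_commutes)
  then have "s * r = r * s" by (intro r) simp
  then have "r\<^sup>2 * s\<^sup>2 = s\<^sup>2 * r\<^sup>2"
    by (metis mult.assoc power2_eq_square)
  moreover have "r ^ 4 + s ^ 4 = of_real (t + (\<delta> + \<delta>))"
    by (simp only: r s of_real_add) simp
  ultimately have "(norm (r\<^sup>2))\<^sup>2 \<le> \<bar>t + (\<delta> + \<delta>)\<bar>"
    using r(1) s(1) by (intro norm_le_of_commuting_sum_squares[of "r\<^sup>2" "s\<^sup>2"])
      (simp_all add: star_simps del: of_real_add)
  moreover have "norm (h + of_real \<delta>) \<le> (norm (r\<^sup>2))\<^sup>2"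
    using norm_power_ineq[of "r\<^sup>2" 2] r by simp
  moreover have "norm h \<le> norm (h + of_real \<delta>) + \<delta>"
    using norm_triangle_ineq4[of "h + of_real \<delta>" "of_real \<delta>"] \<open>\<delta> > 0\<close> by simp
  ultimately show "norm h \<le> \<bar>t\<bar> + e"
    using \<open>e > 0\<close> unfolding \<delta>_def by linarith
qed

text \<open>\<open>norm h - h\<close> lies between \<open>0\<close> and
  \<open>norm h + \<epsilon>\<close>, which bounds its norm. The witness \<open>norm h\<close> does
  not depend on \<open>\<epsilon>\<close>, so \<open>\<epsilon>\<close> may tend to
  \<open>0\<close>.\<close>

lemma norm_positive_closed:
  assumes h: "star h = h" and pos: "\<And>\<epsilon>. \<epsilon> > 0 \<Longrightarrow> norm_positive (h + of_real \<epsilon>)"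
  shows "norm_positive h"
proof -
  have "norm (of_real (norm h) - h) \<le> norm h + \<epsilon>" if "\<epsilon> > 0" for \<epsilon>
  proof -
    have "of_real (norm h + \<epsilon>) - (of_real (norm h) - h) = h + of_real \<epsilon>" by simp
    then have "norm_positive (of_real (norm h + \<epsilon>) - (of_real (norm h) - h))"
      using pos[OF that] by (simp only:)
    from norm_le_of_norm_positive[OF norm_positive_norm_diff[OF h order_refl] this] that
    show ?thesis by simp
  qed
  then have "norm (of_real (norm h) - h) \<le> norm h" by (rule field_le_epsilon)
  then show ?thesis using h unfolding norm_positive_def by (metis norm_ge_zero)
qed

text \<open>Sharpness of this triangle inequality later lets one functional attain its norm at both
  \<open>1\<close> and \<open>h\<close>. With \<open>s = norm (1 + h)\<close>, positivity of
  \<open>s - 1 - h\<close> bounds \<open>norm h\<close> by \<open>s - 1\<close>.\<close>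

lemma norm_one_plus_norm_positive:
  assumes "norm_positive h"
  shows "norm (1 + h) = 1 + norm h"
proof (rule antisym)
  have h: "star h = h" using assms by (simp add: norm_positive_def)
  define s where "s = norm (1 + h)"
  have "norm_positive (of_real s - (1 + h))"
    using h by (intro norm_positive_norm_diff) (auto simp: star_simps s_def)
  then have p: "norm_positive (of_real (s - 1) - h)" by (simp add: algebra_simps)
  \<comment> \<open>Otherwise the negative scalar \<open>s - 1\<close> would be a sum of the
    positive elements \<open>s - 1 - h\<close> and \<open>h\<close>.\<close>
  have "s \<ge> 1"
  proof (rule ccontr)
    assume "\<not> s \<ge> 1"
    have "norm_positive (of_real (s - 1) :: 'a)"
      using norm_positive_add[OF p assms] by (simp del: of_real_diff)
    then obtain t where "t \<ge> 0" "norm (of_real (t - (s - 1)) :: 'a) \<le> t"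
      by (auto simp: norm_positive_def)
    then show False using \<open>\<not> s \<ge> 1\<close> by (simp del: of_real_diff)
  qed
  with norm_le_of_norm_positive[OF assms p] show "1 + norm h \<le> norm (1 + h)"
    by (simp add: s_def)
  show "norm (1 + h) \<le> 1 + norm h" using norm_triangle_ineq[of 1 h] by simp
qed

text \<open>The swap replaces the equality of the non-zero spectra of \<open>star y * y\<close> and \<open>y * star y\<close>.\<close>

lemma norm_positive_swap:
  assumes pos: "norm_positive (of_real \<eta> - star y * y)" and "\<eta> \<ge> 0"
  shows "norm_positive (of_real \<eta> - y * star y)"
proof -
  obtain t0 where t0: "\<And>s. s \<ge> t0 \<Longrightarrow> norm (of_real s - (of_real \<eta> - star y * y)) \<le> s"
    using norm_positive_eventually[OF pos] by blast
  \<comment> \<open>\<open>t0\<close> gives \<open>norm g \<le> t\<close>, \<open>\<eta>\<close>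
    gives \<open>T \<ge> 0\<close>, and \<open>1\<close> gives
    \<open>t ^ n \<le> t * t ^ n\<close>.\<close>
  define t where "t = Max {t0, \<eta>, 1}"
  define T where "T = t - \<eta>"
  define g where "g = of_real T + star y * y"
  define k where "k = of_real T + y * star y"
  have t: "t \<ge> 1" "0 \<le> T" "T \<le> t" using \<open>\<eta> \<ge> 0\<close> by (auto simp: t_def T_def)
  have "g = of_real t - (of_real \<eta> - star y * y)" by (simp add: g_def T_def)
  then have g: "norm g \<le> t" using t0[of t] by (simp add: t_def)
  have ky: "k * y = y * g"
    by (simp add: k_def g_def algebra_simps of_real_commutes)
  \<comment> \<open>The relation \<open>k * y = y * g\<close> moves powers of \<open>k\<close> past
    \<open>y\<close>, so the bound on \<open>g\<close> controls them up to a factor linear in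
    \<open>n\<close>.\<close>
  have k_power: "\<exists>S. k ^ n = of_real (T ^ n) + y * S * star y \<and> norm S \<le> real n * t ^ n" for n
  proof (induction n)
    case 0
    show ?case by (intro exI[of _ 0]) simp
  next
    case (Suc n)
    then obtain S where S: "k ^ n = of_real (T ^ n) + y * S * star y" "norm S \<le> real n * t ^ n"
      by blast
    have "k ^ Suc n = k * of_real (T ^ n) + (k * y) * S * star y"
      by (simp add: S(1) algebra_simps)
    also have "\<dots> = of_real (T ^ Suc n) + y * (of_real (T ^ n) + g * S) * star y"
      unfolding ky
      by (simp add: k_def algebra_simps) (simp add: of_real_def power_commutes)
    finally have eq: "k ^ Suc n = \<dots>" .
    have "norm (of_real (T ^ n) + g * S) \<le> T ^ n + norm g * norm S"
      using t by (intro norm_triangle_le add_mono norm_mult_ineq) (simp del: of_real_power)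
    also have "\<dots> \<le> t ^ n + t * (real n * t ^ n)"
      using t g S by (intro add_mono power_mono mult_mono) auto
    also have "\<dots> \<le> t * t ^ n + t * (real n * t ^ n)"
      using t by (simp add: mult_le_cancel_right1)
    also have "\<dots> = real (Suc n) * t ^ Suc n"
      by (simp add: algebra_simps)
    finally show ?case using eq by blast
  qed
  have "norm k \<le> t"
  proof (rule le_if_two_powers_le[where c = "norm y * norm y"])
    fix n :: nat
    obtain S where S: "k ^ 2 ^ n = of_real (T ^ 2 ^ n) + y * S * star y"
        "norm S \<le> real (2 ^ n) * t ^ 2 ^ n"
      using k_power by blast
    have "norm k ^ 2 ^ n = norm (k ^ 2 ^ n)"
      by (simp add: norm_power_selfadjoint k_def star_simps)
    also have "\<dots> \<le> T ^ 2 ^ n + norm y * norm S * norm y"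
      unfolding S using t norm_mult_ineq[of "y * S" "star y"] norm_mult_ineq[of y S]
      by (intro norm_triangle_le add_mono order_trans[OF norm_mult_ineq])
         (auto simp: norm_star intro!: mult_mono simp del: of_real_power)
    also have "\<dots> \<le> t ^ 2 ^ n + norm y * (real (2 ^ n) * t ^ 2 ^ n) * norm y"
      using t S by (intro add_mono power_mono mult_mono) auto
    finally show "norm k ^ 2 ^ n \<le> (1 + norm y * norm y * 2 ^ n) * t ^ 2 ^ n"
      by (simp add: algebra_simps)
  qed (use t in auto)
  moreover have "of_real t - (of_real \<eta> - y * star y) = k"
    by (simp add: k_def T_def)
  ultimately show ?thesis
    using t unfolding norm_positive_def by (intro conjI exI[of _ t]) (auto simp: star_simps)
qed

text \<open>The squares of the selfadjoint elements \<open>y + star y\<close> and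
  \<open>\<i> (y - star y)\<close> add up to twice this sum.\<close>

lemma norm_positive_square_sum: "norm_positive (star y * y + y * star y)"
proof -
  define u where "u = y + star y"
  define v where "v = scaleC \<i> (y - star y)"
  note lin = linear_simps[OF bounded_linear_scaleC]
  have v: "star v = v"
    unfolding v_def by (simp add: star_simps lin scaleC_minus_left)
  have "v\<^sup>2 = - (y - star y)\<^sup>2"
    by (simp add: v_def power2_eq_square mult_scaleC_left mult_scaleC_right scaleC_ii_ii)
  then have "u\<^sup>2 + v\<^sup>2 = 2 *\<^sub>R (star y * y + y * star y)"
    by (simp add: u_def power2_eq_square algebra_simps scaleR_2)
  then have "star y * y + y * star y = (1/2) *\<^sub>R (u\<^sup>2 + v\<^sup>2)" by simp
  then show ?thesis
    using v by (auto simp: u_def star_simps add.commute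
        intro!: norm_positive_scaleR norm_positive_add norm_positive_square)
qed

text \<open>
  Kaplansky's argument with \<open>m = sqrt (h\<^sup>2 + \<delta>)\<close> in place of \<open>\<bar>h\<bar>\<close>: \<open>p = m - h\<close> approximates twice the negative
  part of \<open>h = star x * x\<close>, and for \<open>y = x * p\<close> both \<open>- star y * y\<close> and, by the swap, \<open>- y * star y\<close> are
  positive up to \<open>O(\<delta>)\<close>. As \<open>star y * y + y * star y\<close> is also positive, \<open>star y * y\<close> and hence \<open>p\<close>
  tend to \<open>0\<close> with \<open>\<delta>\<close>.
\<close>

theorem norm_positive_star_mult_self: "norm_positive (star x * x)"
proof (rule norm_positive_closed)
  define h where "h = star x * x"
  show "star (star x * x) = star x * x" by (simp add: star_simps)
  have h: "star h = h" by (simp add: h_def star_simps)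
  fix \<epsilon> :: real assume "\<epsilon> > 0"
  define C where "C = 2 * norm h + 1"
  \<comment> \<open>The last estimate is \<open>norm p ^ 4 \<le> 7 * C ^ 2 * \<delta>\<close>. The
    bound \<open>\<delta> \<le> 1\<close> gives \<open>norm m \<le> norm h + 1\<close>, hence
    \<open>norm p \<le> C\<close>.\<close>
  define \<delta> where "\<delta> = min 1 (\<epsilon> ^ 4 / (7 * C\<^sup>2))"
  have "C \<ge> 1" by (simp add: C_def)
  have \<delta>: "\<delta> > 0" "\<delta> \<le> 1" "7 * C\<^sup>2 * \<delta> \<le> \<epsilon> ^ 4"
    using \<open>C \<ge> 1\<close> \<open>\<epsilon> > 0\<close> by (auto simp: \<delta>_def min_def field_simps)
  obtain q where q: "star q = q" "q ^ 4 = h\<^sup>2 + of_real \<delta>" "\<And>c. c * h\<^sup>2 = h\<^sup>2 * c \<Longrightarrow> c * q = q * c"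
    using norm_positive_fourth_root[OF norm_positive_square[OF h] \<delta>(1)] by blast
  define m where "m = q\<^sup>2"
  define p where "p = m - h"
  define y where "y = x * p"
  have m: "star m = m" "m\<^sup>2 = h\<^sup>2 + of_real \<delta>" "norm_positive m"
    using q by (auto simp: m_def star_simps norm_positive_square)
  have p: "star p = p" using m h by (simp add: p_def star_simps)
  have hq: "h * q = q * h" by (rule q) (simp add: power2_eq_square mult.assoc)
  then have hm: "h * m = m * h" unfolding m_def by (metis mult.assoc power2_eq_square)
  have qp: "q * p = p * q" by (simp add: p_def m_def hq algebra_simps power2_eq_square)
  have hp: "h * p = p * h" by (simp add: p_def hm algebra_simps)
  have yy: "star y * y = h * (p * p)"
  proof -
    have "star y * y = (p * h) * p" by (simp add: y_def h_def star_simps p mult.assoc)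
    then show ?thesis unfolding hp[symmetric] by (simp only: mult.assoc)
  qed
  have qpqp: "(q * p)\<^sup>2 = m * (p * p)"
    unfolding power2_eq_square m_def by (metis qp mult.assoc)
  have "(m + h) * p = of_real \<delta>"
    using m(2) by (simp add: p_def algebra_simps hm power2_eq_square)
  then have sum: "m * (p * p) + star y * y = \<delta> *\<^sub>R p"
    unfolding yy by (metis distrib_right mult.assoc scaleR_conv_of_real)
  have "(norm m)\<^sup>2 \<le> (norm h + 1)\<^sup>2"
  proof -
    have "(norm m)\<^sup>2 = norm (h\<^sup>2 + of_real \<delta>)"
      using norm_power_selfadjoint[OF m(1), of 1] m(2) by simp
    also have "\<dots> \<le> (norm h)\<^sup>2 + 1"
      using \<delta> norm_power_ineq[of h 2] by (intro norm_triangle_le add_mono) auto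
    also have "\<dots> \<le> (norm h + 1)\<^sup>2" by (simp add: power2_sum)
    finally show ?thesis .
  qed
  then have "norm m \<le> norm h + 1" by (rule power2_le_imp_le) simp
  then have pC: "norm p \<le> C" using norm_triangle_ineq4[of m h] by (simp add: p_def C_def)
  define \<eta> where "\<eta> = \<delta> * C"
  have "\<eta> \<ge> 0" using \<delta> \<open>C \<ge> 1\<close> by (simp add: \<eta>_def)
  \<comment> \<open>\<open>star y * y\<close> is \<open>\<delta> * p\<close> minus the square of
    \<open>q * p\<close>, and \<open>C - p\<close> is positive.\<close>
  have neg: "norm_positive (of_real \<eta> - star y * y)"
  proof -
    have "of_real \<eta> - star y * y = (q * p)\<^sup>2 + \<delta> *\<^sub>R (of_real C - p)"
      using sum by (simp add: qpqp \<eta>_def algebra_simps of_real_def)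
    moreover have "norm_positive ((q * p)\<^sup>2)"
      using p q qp by (intro norm_positive_square) (simp add: star_simps)
    ultimately show ?thesis
      using pC p \<delta> by (auto intro!: norm_positive_add norm_positive_scaleR norm_positive_norm_diff)
  qed
  \<comment> \<open>Adding the swapped bound to the sum of both products cancels
    \<open>y * star y\<close>.\<close>
  have "norm_positive (star y * y + of_real \<eta>)"
    using norm_positive_add[OF norm_positive_square_sum[of y] norm_positive_swap[OF neg \<open>\<eta> \<ge> 0\<close>]]
    by (simp add: algebra_simps)
  moreover have "of_real (2 * \<eta>) - (star y * y + of_real \<eta>) = of_real \<eta> - star y * y"
    unfolding mult_2 of_real_add by simp
  ultimately have "norm (star y * y + of_real \<eta>) \<le> \<bar>2 * \<eta>\<bar>"
    using neg by (intro norm_le_of_norm_positive) (simp_all only:)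
  then have yn: "norm (star y * y) \<le> 3 * \<eta>"
    using norm_triangle_ineq4[of "star y * y + of_real \<eta>" "of_real \<eta>"] \<open>\<eta> \<ge> 0\<close> by simp
  \<comment> \<open>As \<open>p = m - h\<close>, this is \<open>m * (p * p) - h * (p * p)\<close>,
    and \<open>sum\<close> and \<open>yy\<close> express both terms through
    \<open>star y * y\<close>.\<close>
  have "p * (p * p) = \<delta> *\<^sub>R p - star y * y - star y * y"
    unfolding sum[symmetric] by (simp add: yy p_def algebra_simps)
  then have "norm (p * (p * p)) \<le> \<delta> * norm p + norm (star y * y) + norm (star y * y)"
    using \<delta> norm_triangle_ineq4[of "\<delta> *\<^sub>R p - star y * y" "star y * y"]
      norm_triangle_ineq4[of "\<delta> *\<^sub>R p" "star y * y"] by simp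
  also have "\<dots> \<le> 7 * \<eta>"
    using yn mult_left_mono[OF pC less_imp_le[OF \<delta>(1)]] unfolding \<eta>_def by simp
  finally have ppp: "norm (p * (p * p)) \<le> 7 * \<eta>" .
  have "norm p ^ 4 = norm (p * (p * (p * p)))"
    using norm_power_selfadjoint[OF p, of 2] by (simp add: power4_eq_xxxx mult.assoc)
  also have "\<dots> \<le> C * (7 * \<eta>)"
    by (rule order_trans[OF norm_mult_ineq mult_mono[OF pC ppp]]) (use \<open>C \<ge> 1\<close> in auto)
  also have "\<dots> \<le> \<epsilon> ^ 4"
    using \<delta>(3) by (simp add: \<eta>_def power2_eq_square mult_ac)
  finally have "norm p \<le> \<epsilon>"
    using \<open>\<epsilon> > 0\<close> by (simp add: power_mono_iff)
  \<comment> \<open>This sum is \<open>h + \<epsilon>\<close>, because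
    \<open>m - p = h\<close>.\<close>
  then have "norm_positive (m + (of_real \<epsilon> - p))"
    using m p by (intro norm_positive_add norm_positive_norm_diff) auto
  then show "norm_positive (star x * x + of_real \<epsilon>)"
    by (simp add: p_def h_def algebra_simps)
qed

section \<open>The Hahn-Banach theorem and existence of states\<close>

text \<open>Homogeneity is demanded only as an inequality, which is easier to check for infima;
  applying it with \<open>1 / c\<close> recovers equality.\<close>

definition sublinear :: "('a::real_vector \<Rightarrow> real) \<Rightarrow> bool" where
  "sublinear q \<longleftrightarrow> (\<forall>x y. q (x + y) \<le> q x + q y) \<and> (\<forall>c>0. \<forall>x. q (c *\<^sub>R x) \<le> c * q x)"

lemma sublinear_add: "sublinear q \<Longrightarrow> q (x + y) \<le> q x + q y"
  and sublinear_scaleR_le: "sublinear q \<Longrightarrow> c > 0 \<Longrightarrow> q (c *\<^sub>R x) \<le> c * q x"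
  by (auto simp: sublinear_def)

lemma sublinear_scaleR:
  assumes "sublinear q" "c > 0"
  shows "q (c *\<^sub>R x) = c * q x"
  using sublinear_scaleR_le[OF assms, of x] sublinear_scaleR_le[OF assms(1), of "1/c" "c *\<^sub>R x"] assms(2)
  by (simp add: field_simps)

lemma sublinear_zero: "sublinear q \<Longrightarrow> q 0 = 0"
  using sublinear_scaleR[of q 2 0] by simp

lemma sublinear_minus_le: "sublinear q \<Longrightarrow> - q (- x) \<le> q x"
  using sublinear_add[of q x "- x"] sublinear_zero[of q] by simp

text \<open>For sublinear \<open>q\<close> this is a sublinear minorant whose value at
  \<open>- y\<close> is at most \<open>- q y\<close> (take \<open>t = 1\<close>), so every linear
  functional below it agrees with \<open>q\<close> at \<open>y\<close>.\<close>

definition sublinear_shift :: "('a::real_vector \<Rightarrow> real) \<Rightarrow> 'a \<Rightarrow> 'a \<Rightarrow> real" where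
  "sublinear_shift q y x = (INF t\<in>{0..}. q (x + t *\<^sub>R y) - t * q y)"

lemma sublinear_shift_le:
  assumes "sublinear q" "t \<ge> 0"
  shows "sublinear_shift q y x \<le> q (x + t *\<^sub>R y) - t * q y"
  unfolding sublinear_shift_def
proof (rule cINF_lower)
  \<comment> \<open>Subadditivity yields a lower bound independent of \<open>t\<close>, so the
    infimum is a genuine one.\<close>
  have "- q (- x) \<le> q (x + t *\<^sub>R y) - t * q y" if "t \<ge> 0" for t
    using sublinear_add[OF assms(1), of "x + t *\<^sub>R y" "- x"] sublinear_scaleR[OF assms(1), of t y]
      sublinear_zero[OF assms(1)] that by (cases "t = 0") (auto simp: sublinear_minus_le[OF assms(1)])
  then show "bdd_below ((\<lambda>t. q (x + t *\<^sub>R y) - t * q y) ` {0..})"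
    by (intro bdd_belowI2) auto
qed (use assms in auto)

lemma sublinear_shift_greatest:
  assumes "\<And>t. t \<ge> 0 \<Longrightarrow> c \<le> q (x + t *\<^sub>R y) - t * q y"
  shows "c \<le> sublinear_shift q y x"
  unfolding sublinear_shift_def using assms by (intro cINF_greatest) auto

lemma sublinear_shift_le_self: "sublinear q \<Longrightarrow> sublinear_shift q y x \<le> q x"
  using sublinear_shift_le[of q 0 y x] by simp

lemma sublinear_sublinear_shift:
  assumes q: "sublinear q"
  shows "sublinear (sublinear_shift q y)"
  unfolding sublinear_def
proof (intro conjI allI impI)
  fix x z
  have "sublinear_shift q y (x + z) - (q (z + s *\<^sub>R y) - s * q y) \<le> q (x + t *\<^sub>R y) - t * q y"
    if "s \<ge> 0" "t \<ge> 0" for s t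
    using sublinear_shift_le[OF q, of "t + s" y "x + z"] that
      sublinear_add[OF q, of "x + t *\<^sub>R y" "z + s *\<^sub>R y"] by (simp add: algebra_simps)
  then have "sublinear_shift q y (x + z) - (q (z + s *\<^sub>R y) - s * q y) \<le> sublinear_shift q y x"
    if "s \<ge> 0" for s
    using that by (intro sublinear_shift_greatest)
  then have "sublinear_shift q y (x + z) - sublinear_shift q y x \<le> q (z + s *\<^sub>R y) - s * q y"
    if "s \<ge> 0" for s
    using that by (fastforce simp: algebra_simps)
  then have "sublinear_shift q y (x + z) - sublinear_shift q y x \<le> sublinear_shift q y z"
    by (intro sublinear_shift_greatest)
  then show "sublinear_shift q y (x + z) \<le> sublinear_shift q y x + sublinear_shift q y z" by simp
next
  fix c :: real and x assume "c > 0"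
  have "sublinear_shift q y (c *\<^sub>R x) / c \<le> q (x + t *\<^sub>R y) - t * q y" if "t \<ge> 0" for t
    using sublinear_shift_le[OF q, of "c * t" y "c *\<^sub>R x"] that \<open>c > 0\<close>
      sublinear_scaleR[OF q \<open>c > 0\<close>, of "x + t *\<^sub>R y"] by (simp add: field_simps scaleR_add_right)
  then have "sublinear_shift q y (c *\<^sub>R x) / c \<le> sublinear_shift q y x"
    by (intro sublinear_shift_greatest)
  then show "sublinear_shift q y (c *\<^sub>R x) \<le> c * sublinear_shift q y x"
    using \<open>c > 0\<close> by (simp add: field_simps)
qed

text \<open>Zorn's lemma for the reversed order. The pointwise infimum bounds a chain from below; it
  is finite because members of the chain are at least \<open>- p (- x)\<close> at
  \<open>x\<close>.\<close>

lemma minimal_sublinear_exists: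
  assumes p: "sublinear p"
  obtains m where "sublinear m" "m \<le> p" "\<And>q. sublinear q \<Longrightarrow> q \<le> m \<Longrightarrow> q = m"
proof -
  define A where "A = {q. sublinear q \<and> q \<le> p}"
  have "\<exists>m\<in>A. \<forall>q\<in>A. q \<le> m \<longrightarrow> q = m"
  proof (rule predicate_Zorn[where P = "\<lambda>f g. g \<le> f"])
    show "partial_order_on A (relation_of (\<lambda>f g. g \<le> f) A)"
      by (rule partial_order_on_relation_ofI) auto
    fix C assume "C \<in> Chains (relation_of (\<lambda>f g. g \<le> f) A)"
    then have CA: "q \<in> A" and total: "q \<le> r \<or> r \<le> q" if "q \<in> C" "r \<in> C" for q r
      using that by (auto simp: Chains_def relation_of_def)
    show "\<exists>u\<in>A. \<forall>q\<in>C. u \<le> q"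
    proof (cases "C = {}")
      case True
      then show ?thesis using p by (auto simp: A_def)
    next
      case False
      define u where "u x = (INF q\<in>C. q x)" for x
      have "- p (- x) \<le> q x" if "q \<in> C" for q x
        using CA[OF that that] sublinear_minus_le[of q x] le_funD[of q p "- x"]
        by (fastforce simp: A_def)
      then have bdd: "bdd_below ((\<lambda>q. q x) ` C)" for x
        by (intro bdd_belowI2) auto
      have lower: "u x \<le> q x" if "q \<in> C" for q x
        unfolding u_def by (rule cINF_lower[OF bdd that])
      have greatest: "c \<le> u x" if "\<And>q. q \<in> C \<Longrightarrow> c \<le> q x" for c x
        unfolding u_def using False that by (intro cINF_greatest) auto
      have "sublinear u"
        unfolding sublinear_def
      proof (intro conjI allI impI)
        fix x y
        \<comment> \<open>Members of a chain are comparable, so a single sublinear functional lies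
          below both \<open>q\<close> and \<open>r\<close>.\<close>
        have "u (x + y) - q x \<le> r y" if qr: "q \<in> C" "r \<in> C" for q r
        proof -
          obtain s where s: "s \<in> C" "s \<le> q" "s \<le> r" using total[OF qr] qr by blast
          then have "u (x + y) \<le> s x + s y"
            using lower[of s "x + y"] sublinear_add[of s x y] CA[of s s] by (simp add: A_def)
          then show ?thesis using le_funD[OF s(2), of x] le_funD[OF s(3), of y] by simp
        qed
        then have "u (x + y) - q x \<le> u y" if "q \<in> C" for q
          using that by (intro greatest)
        then have "u (x + y) - u y \<le> q x" if "q \<in> C" for q
          using that by (fastforce simp: algebra_simps)
        then have "u (x + y) - u y \<le> u x" by (intro greatest)
        then show "u (x + y) \<le> u x + u y" by simp
      next
        fix c :: real and x assume "c > 0"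
        have "u (c *\<^sub>R x) / c \<le> q x" if "q \<in> C" for q
          using lower[OF that, of "c *\<^sub>R x"] sublinear_scaleR[of q c x] CA[OF that that] \<open>c > 0\<close>
          by (simp add: A_def field_simps)
        then have "u (c *\<^sub>R x) / c \<le> u x" by (intro greatest)
        then show "u (c *\<^sub>R x) \<le> c * u x" using \<open>c > 0\<close> by (simp add: field_simps)
      qed
      moreover have "u \<le> q" if "q \<in> C" for q
        using lower[OF that] by (simp add: le_funI)
      moreover have "u \<le> p"
        using False CA calculation(2) by (fastforce simp: A_def intro: order_trans)
      ultimately show ?thesis by (auto simp: A_def)
    qed
  qed
  then obtain m where "m \<in> A" "\<And>q. q \<in> A \<Longrightarrow> q \<le> m \<Longrightarrow> q = m" by blast
  then show ?thesis
    using that by (auto simp: A_def intro: order_trans)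
qed

text \<open>Minimality forces every \<open>sublinear_shift m y\<close> to be \<open>m\<close>, which makes \<open>m\<close> superadditive.\<close>

lemma linear_of_minimal_sublinear:
  assumes m: "sublinear m" and min: "\<And>q. sublinear q \<Longrightarrow> q \<le> m \<Longrightarrow> q = m"
  shows "linear m"
proof -
  have "sublinear_shift m y = m" for y
    using m by (intro min sublinear_sublinear_shift le_funI sublinear_shift_le_self)
  then have add: "m (x + y) = m x + m y" for x y
    using sublinear_shift_le[OF m, of 1 y x] sublinear_add[OF m, of x y] by fastforce
  then have minus: "m (- x) = - m x" for x
    using add[of x "- x"] sublinear_zero[OF m] by simp
  have "m (c *\<^sub>R x) = c * m x" for c x
    using sublinear_scaleR[OF m, of c x] sublinear_scaleR[OF m, of "- c" x] sublinear_zero[OF m]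
      minus[of "c *\<^sub>R x"] by (cases c "0::real" rule: linorder_cases) auto
  with add show ?thesis by (intro linearI) auto
qed

text \<open>A minimal sublinear functional below \<open>sublinear_shift p v\<close> is linear, and
  the shift forces \<open>f (- v) \<le> - p v\<close>.\<close>

theorem Hahn_Banach_support:
  assumes p: "sublinear p"
  obtains f where "linear f" "\<And>x. f x \<le> p x" "f v = p v"
proof -
  obtain f where f: "sublinear f" "f \<le> sublinear_shift p v"
      "\<And>q. sublinear q \<Longrightarrow> q \<le> f \<Longrightarrow> q = f"
    using minimal_sublinear_exists[OF sublinear_sublinear_shift[OF p]] by blast
  have lin: "linear f" using f by (intro linear_of_minimal_sublinear)
  have le: "f x \<le> p x" for x
    using le_funD[OF f(2)] sublinear_shift_le_self[OF p] by (rule order_trans)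
  have "f (- v) \<le> - p v"
    using le_funD[OF f(2), of "- v"] sublinear_shift_le[OF p, of 1 v "- v"] sublinear_zero[OF p] by simp
  then have "f v = p v" using le[of v] by (simp add: linear_neg[OF lin])
  with lin le show ?thesis using that by blast
qed

text \<open>A norm-one functional attaining its norm at both \<open>1\<close> and the given element is a state.\<close>

theorem positive_functional_exists:
  fixes b :: "'a::unital_cstar_algebra"
  obtains \<phi> where "\<phi> \<in> dual_space" "positive_functional \<phi>" "\<phi> (star b * b) = of_real (norm (star b * b))"
proof -
  define a where "a = star b * b"
  have "sublinear (norm :: 'a \<Rightarrow> real)" by (auto simp: sublinear_def norm_triangle_ineq)
  \<comment> \<open>Since \<open>norm (1 + a) = 1 + norm a\<close>, attaining the norm at
    \<open>1 + a\<close> forces both \<open>f 1 = 1\<close> and \<open>f a = norm a\<close>.\<close>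
  then obtain f :: "'a \<Rightarrow> real" where f: "linear f" "\<And>x. f x \<le> norm x" "f (1 + a) = norm (1 + a)"
    using Hahn_Banach_support by blast
  note lin = linear_add[OF f(1)] linear_diff[OF f(1)] linear_neg[OF f(1)] linear_0[OF f(1)]
    linear_scale[OF f(1)]
  have "norm (1 + a) = 1 + norm a"
    unfolding a_def by (intro norm_one_plus_norm_positive norm_positive_star_mult_self)
  then have f1: "f 1 = 1" and fa: "f a = norm a"
    using f(2)[of 1] f(2)[of a] f(3) lin by auto
  \<comment> \<open>Compare \<open>t - f h = f (t - h)\<close> with
    \<open>norm (t - h) \<le> t\<close>.\<close>
  have f_nonneg: "f h \<ge> 0" if h: "norm_positive h" for h
  proof -
    obtain t where "norm (of_real t - h) \<le> t" using h by (auto simp: norm_positive_def)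
    then show ?thesis
      using f(2)[of "of_real t - h"] lin f1 by (simp add: of_real_def)
  qed
  have abs_f: "\<bar>f x\<bar> \<le> norm x" for x
    using f(2)[of x] f(2)[of "- x"] lin by simp
  \<comment> \<open>Averaging with the adjoint keeps \<open>f\<close> on selfadjoint elements and
    kills skew-adjoint ones, so the complexification \<open>\<phi>\<close> is real on selfadjoint
    elements.\<close>
  define g where "g x = f ((1/2) *\<^sub>R (x + star x))" for x
  have g_add: "g (x + y) = g x + g y" and g_scale: "g (r *\<^sub>R x) = r * g x" for x y r
    by (simp_all add: g_def star_simps algebra_simps lin)
  have g_minus: "g (- x) = - g x" for x using g_scale[of "-1" x] by simp
  have g_bound: "\<bar>g x\<bar> \<le> norm x" for x
    using abs_f[of "(1/2) *\<^sub>R (x + star x)"] norm_triangle_ineq[of x "star x"]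
    by (simp add: g_def norm_star)
  define \<phi> where "\<phi> x = complex_of_real (g x) - \<i> * complex_of_real (g (scaleC \<i> x))" for x
  have \<phi>_sa: "\<phi> h = of_real (f h)" if "star h = h" for h
    using that by (simp add: \<phi>_def g_def star_simps scaleC_minus_left lin flip: scaleR_2)
  have "bounded_linear \<phi>"
  proof (rule bounded_linear_intro)
    show "\<phi> (x + y) = \<phi> x + \<phi> y" for x y
      by (simp add: \<phi>_def g_add scaleC_add_right algebra_simps)
    show "\<phi> (r *\<^sub>R x) = r *\<^sub>R \<phi> x" for r x
      by (simp add: \<phi>_def g_scale linear_simps(5)[OF bounded_linear_scaleC] scaleR_conv_of_real[where 'a = complex] algebra_simps)
    show "norm (\<phi> x) \<le> norm x * 2" for x
      unfolding \<phi>_def using g_bound[of x] g_bound[of "scaleC \<i> x"]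
      by (intro norm_triangle_le_diff) (simp add: norm_mult norm_scaleC)
  qed
  moreover have "\<phi> (scaleC c x) = c * \<phi> x" for c x
  proof -
    have c: "scaleC c x = Re c *\<^sub>R x + Im c *\<^sub>R scaleC \<i> x"
      using complex_eq[of c] scaleC_add_left[of "of_real (Re c)" "of_real (Im c) * \<i>" x]
      by (simp add: scaleC_of_real linear_simps(5)[OF bounded_linear_scaleC] mult.commute flip: scaleC_scaleC)
    have "scaleC \<i> (scaleC c x) = Re c *\<^sub>R scaleC \<i> x - Im c *\<^sub>R x"
      unfolding c by (simp add: scaleC_add_right linear_simps(5)[OF bounded_linear_scaleC] scaleC_ii_ii)
    then have "g (scaleC \<i> (scaleC c x)) = Re c * g (scaleC \<i> x) - Im c * g x"
      using g_add[of "Re c *\<^sub>R scaleC \<i> x" "- (Im c *\<^sub>R x)"] by (simp add: g_scale g_minus)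
    moreover have "g (scaleC c x) = Re c * g x + Im c * g (scaleC \<i> x)"
      unfolding c by (simp add: g_add g_scale)
    ultimately show ?thesis
      by (simp add: \<phi>_def complex_eq_iff)
  qed
  ultimately have "\<phi> \<in> dual_space" by (simp add: dual_space_def)
  moreover have "positive_functional \<phi>"
    using f_nonneg[OF norm_positive_star_mult_self]
    by (simp add: positive_functional_def \<phi>_sa star_simps)
  moreover have "\<phi> (star b * b) = of_real (norm (star b * b))"
    using fa by (simp add: \<phi>_sa star_simps a_def)
  ultimately show ?thesis using that by blast
qed

section \<open>The semi-inner product of an \<open>a\<close>-state\<close>

lemma is_a_adjoint_swap:
  assumes "star a = a" "is_a_adjoint a x y"
  shows "is_a_adjoint a y x"
  using arg_cong[of _ _ star, OF assms(2)[unfolded is_a_adjoint_def]]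
  by (simp add: is_a_adjoint_def star_simps assms(1))

lemma is_a_adjoint_mult:
  assumes "is_a_adjoint a x x'" "is_a_adjoint a y y'"
  shows "is_a_adjoint a (x * y) (y' * x')"
  using assms unfolding is_a_adjoint_def star_mult by (metis mult.assoc)

lemma is_a_adjoint_add:
  "is_a_adjoint a x x' \<Longrightarrow> is_a_adjoint a y y' \<Longrightarrow> is_a_adjoint a (x + y) (x' + y')"
  by (simp add: is_a_adjoint_def star_add algebra_simps)

lemma is_a_adjoint_scaleR: "is_a_adjoint a x x' \<Longrightarrow> is_a_adjoint a (r *\<^sub>R x) (r *\<^sub>R x')"
  by (simp add: is_a_adjoint_def star_scaleR)

lemma is_a_adjoint_sum:
  assumes "\<And>i. i \<in> I \<Longrightarrow> is_a_adjoint a (f i) (g i)"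
  shows "is_a_adjoint a (sum f I) (sum g I)"
  using assms by (simp add: is_a_adjoint_def star_sum sum_distrib_left sum_distrib_right)

lemma is_a_adjoint_self_power:
  "is_a_adjoint a y y \<Longrightarrow> is_a_adjoint a (y ^ n) (y ^ n)"
proof (induction n)
  case (Suc n)
  then show ?case using is_a_adjoint_mult[of a y y "y ^ n" "y ^ n"] by (simp add: power_commutes)
qed (simp add: is_a_adjoint_def star_one)

text \<open>A positive functional with value \<open>norm a\<close> at \<open>a\<close> is divided by
  \<open>norm a\<close>.\<close>

lemma a_states_nonempty:
  assumes "positive_element a" "a \<noteq> 0"
  shows "a_states a \<noteq> {}"
proof -
  obtain b where a: "a = star b * b" using assms by (auto simp: positive_element_def)
  obtain \<phi> where \<phi>: "\<phi> \<in> dual_space" "positive_functional \<phi>" "\<phi> a = of_real (norm a)"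
    using positive_functional_exists unfolding a by blast
  define \<psi> where "\<psi> = (\<lambda>x. of_real (1 / norm a) * \<phi> x)"
  have "bounded_linear \<psi>"
    using \<phi>(1) unfolding \<psi>_def dual_space_def by (intro bounded_linear_const_mult) simp
  then have "\<psi> \<in> dual_space"
    using \<phi>(1) by (auto simp: dual_space_def \<psi>_def)
  moreover have "positive_functional \<psi>"
    using \<phi>(2) unfolding positive_functional_def \<psi>_def
    by (auto intro!: nonneg_Reals_mult_I)
  moreover have "\<psi> a = 1" using \<phi>(3) assms(2) by (simp add: \<psi>_def)
  ultimately show ?thesis by (auto simp: a_states_def)
qed

lemma positive_functional_cauchy_schwarz:
  fixes u v :: "'a::unital_cstar_algebra"
  assumes \<phi>: "\<phi> \<in> dual_space" and pos: "positive_functional \<phi>"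
  shows "(cmod (\<phi> (star u * v)))\<^sup>2 \<le> Re (\<phi> (star u * u)) * Re (\<phi> (star v * v))"
    and "\<phi> (star v * u) = cnj (\<phi> (star u * v))"
proof -
  define z where "z = \<phi> (star u * v)"
  define A where "A = Re (\<phi> (star u * u))"
  define B where "B = Re (\<phi> (star v * v))"
  have blin: "bounded_linear \<phi>" and scale: "\<phi> (scaleC c x) = c * \<phi> x" for c x
    using \<phi> by (auto simp: dual_space_def)
  note lin = linear_simps[OF blin]
  have sq: "\<phi> (star x * x) \<in> \<real>\<^sub>\<ge>\<^sub>0" for x
    using pos by (simp add: positive_functional_def)
  have expand: "\<phi> (star (u + scaleC c v) * (u + scaleC c v))
      = \<phi> (star u * u) + c * z + cnj c * \<phi> (star v * u) + cnj c * c * \<phi> (star v * v)" for c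
    by (simp add: star_simps algebra_simps mult_scaleC_left mult_scaleC_right scale lin z_def)
  have im: "Im (\<phi> (star u * u)) = 0" "Im (\<phi> (star v * v)) = 0"
    using sq[of u] sq[of v] by (auto simp: complex_nonneg_Reals_iff)
  \<comment> \<open>The expansion has non-negative, hence real, values; \<open>c = 1\<close> and
    \<open>c = \<i>\<close> give Hermitian symmetry.\<close>
  have "Im (z + \<phi> (star v * u)) = 0" "Im (\<i> * z - \<i> * \<phi> (star v * u)) = 0"
    using sq[of "u + scaleC 1 v"] sq[of "u + scaleC \<i> v"] im unfolding expand
    by (auto simp: complex_nonneg_Reals_iff)
  then show vu: "\<phi> (star v * u) = cnj (\<phi> (star u * v))"
    by (simp add: complex_eq_iff z_def)
  \<comment> \<open>The choice \<open>c = - t * cnj z\<close> makes the cross terms real and leaves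
    a quadratic in \<open>t\<close>.\<close>
  have quad: "0 \<le> A - 2 * t * (cmod z)\<^sup>2 + t\<^sup>2 * (cmod z)\<^sup>2 * B" for t :: real
  proof -
    have "\<phi> (star (u + scaleC (- of_real t * cnj z) v) * (u + scaleC (- of_real t * cnj z) v))
        = \<phi> (star u * u) - 2 * of_real t * (z * cnj z) + (of_real t)\<^sup>2 * (z * cnj z) * \<phi> (star v * v)"
      unfolding expand by (simp add: vu flip: z_def) (simp add: power2_eq_square algebra_simps)
    also have "Re \<dots> = A - 2 * t * (cmod z)\<^sup>2 + t\<^sup>2 * (cmod z)\<^sup>2 * B"
      using im by (simp add: A_def B_def complex_mult_cnj cmod_power2 flip: of_real_power of_real_add)
    finally show ?thesis
      using sq by (metis complex_nonneg_Reals_iff)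
  qed
  have "B \<ge> 0" using sq[of v] by (simp add: B_def complex_nonneg_Reals_iff)
  show "(cmod (\<phi> (star u * v)))\<^sup>2 \<le> Re (\<phi> (star u * u)) * Re (\<phi> (star v * v))"
  proof (cases "B = 0")
    case True
    have "z = 0"
    proof (rule ccontr)
      assume "z \<noteq> 0"
      \<comment> \<open>With \<open>B = 0\<close> this \<open>t\<close> gives the value
        \<open>-1\<close>.\<close>
      then show False using quad[of "(A + 1) / (2 * (cmod z)\<^sup>2)"] True by simp
    qed
    then show ?thesis using True by (simp add: z_def B_def)
  next
    case False
    then have "B > 0" using \<open>B \<ge> 0\<close> by simp
    \<comment> \<open>\<open>t = 1 / B\<close> minimises the quadratic.\<close>
    then have "(cmod z)\<^sup>2 \<le> A * B"
      using quad[of "1 / B"] by (simp add: field_simps power2_eq_square)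
    then show ?thesis by (simp add: z_def A_def B_def)
  qed
qed

locale a_state =
  fixes a :: "'a::unital_cstar_algebra" and \<phi> :: "'a \<Rightarrow> complex"
  assumes positive: "positive_element a" and state: "\<phi> \<in> a_states a"
begin

definition sqnorm :: "'a \<Rightarrow> real" where
  "sqnorm u = Re (\<phi> (star u * a * u))"

lemma star_a: "star a = a"
  using positive by (auto simp: positive_element_def star_simps)

lemma blin: "bounded_linear \<phi>"
  and scale: "\<phi> (scaleC c x) = c * \<phi> x"
  and \<phi>_a: "\<phi> a = 1"
  using state by (auto simp: a_states_def dual_space_def)

lemmas lin = linear_simps[OF blin]

lemma \<phi>_sum: "\<phi> (sum f I) = (\<Sum>i\<in>I. \<phi> (f i))"
  by (rule linear_sum) (rule bounded_linear.linear[OF blin])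

text \<open>Writing \<open>a = star b * b\<close> turns the form into
  \<open>\<phi> (star (b * u) * (b * v))\<close>.\<close>

lemma cauchy_schwarz: "(cmod (\<phi> (star u * a * v)))\<^sup>2 \<le> sqnorm u * sqnorm v"
  and form_cnj: "\<phi> (star v * a * u) = cnj (\<phi> (star u * a * v))"
proof -
  obtain b where a: "a = star b * b" using positive by (auto simp: positive_element_def)
  have eq: "star (b * u) * (b * v) = star u * a * v" for u v
    by (simp add: a star_simps mult.assoc)
  have \<phi>: "\<phi> \<in> dual_space" "positive_functional \<phi>" using state by (auto simp: a_states_def)
  show "(cmod (\<phi> (star u * a * v)))\<^sup>2 \<le> sqnorm u * sqnorm v"
    using positive_functional_cauchy_schwarz(1)[OF \<phi>, of "b * u" "b * v"]
    unfolding eq sqnorm_def .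
  show "\<phi> (star v * a * u) = cnj (\<phi> (star u * a * v))"
    using positive_functional_cauchy_schwarz(2)[OF \<phi>, of "b * v" "b * u"] unfolding eq .
qed

lemma sqnorm_nonneg: "sqnorm u \<ge> 0"
proof -
  obtain b where a: "a = star b * b" using positive by (auto simp: positive_element_def)
  have "star u * a * u = star (b * u) * (b * u)"
    by (simp add: a star_simps mult.assoc)
  moreover have "\<phi> (star (b * u) * (b * u)) \<in> \<real>\<^sub>\<ge>\<^sub>0"
    using state by (auto simp: a_states_def positive_functional_def)
  ultimately show ?thesis
    by (simp add: sqnorm_def complex_nonneg_Reals_iff)
qed

lemma form_self: "\<phi> (star u * a * u) = of_real (sqnorm u)"
  using form_cnj[of u u] by (simp add: sqnorm_def complex_eq_iff)

lemma norm_form_le: "cmod (\<phi> (star u * a * v)) \<le> sqrt (sqnorm u) * sqrt (sqnorm v)"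
  using cauchy_schwarz[of u v] by (simp flip: real_sqrt_mult add: real_le_rsqrt)

lemma sqnorm_one: "sqnorm 1 = 1"
  by (simp add: sqnorm_def star_one \<phi>_a)

lemma norm_state_le: "cmod (\<phi> (a * x)) \<le> sqrt (sqnorm x)"
  using norm_form_le[of 1 x] by (simp add: star_one sqnorm_one)

text \<open>Iterating Cauchy-Schwarz against the unit vector \<open>1\<close> bounds the
  \<open>2 ^ n\<close>-th power of the left side by \<open>cmod (\<phi> (a * y ^ 2 ^ n))\<close>;
  boundedness of \<open>\<phi>\<close> then costs only a constant, which the growth lemma
  removes.\<close>

lemma norm_state_self_adjoint_le:
  assumes y: "is_a_adjoint a y y"
  shows "cmod (\<phi> (a * y)) \<le> norm y"
proof -
  obtain K where K: "\<And>x. norm (\<phi> x) \<le> norm x * K" and "K \<ge> 0"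
    using bounded_linear.nonneg_bounded[OF blin] by blast
  have "cmod (\<phi> (a * y)) ^ 2 ^ n \<le> (1 + (norm a * K) * 2 ^ n) * norm y ^ 2 ^ n" for n
  proof -
    have "cmod (\<phi> (a * y)) ^ 2 ^ n \<le> cmod (\<phi> (a * y ^ 2 ^ n))"
    proof (induction n)
      case (Suc n)
      define w where "w = y ^ 2 ^ n"
      have "star w * a = a * w"
        using is_a_adjoint_self_power[OF y] by (simp add: w_def is_a_adjoint_def)
      then have "sqnorm w = Re (\<phi> (a * (w * w)))" by (simp add: sqnorm_def mult.assoc)
      then have "(cmod (\<phi> (a * w)))\<^sup>2 \<le> cmod (\<phi> (a * (w * w)))"
        using norm_state_le[of w] sqnorm_nonneg[of w] complex_Re_le_cmod
        by (metis norm_ge_zero order_trans real_sqrt_pow2 power_mono)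
      moreover have "cmod (\<phi> (a * y)) ^ 2 ^ Suc n \<le> (cmod (\<phi> (a * w)))\<^sup>2"
        using power_mono[OF Suc, of 2] by (simp add: w_def mult.commute flip: power_mult)
      ultimately show ?case by (simp add: w_def mult_2 power_add)
    qed simp
    also have "\<dots> \<le> norm (a * y ^ 2 ^ n) * K" by (rule K)
    also have "\<dots> \<le> (norm a * norm y ^ 2 ^ n) * K"
      using \<open>K \<ge> 0\<close> by (intro mult_right_mono order_trans[OF norm_mult_ineq] mult_left_mono norm_power_ineq) auto
    also have "\<dots> \<le> (1 + (norm a * K) * 2 ^ n) * norm y ^ 2 ^ n"
    proof -
      have "norm a * K \<le> (norm a * K) * 2 ^ n"
        using \<open>K \<ge> 0\<close> mult_left_mono[of 1 "2 ^ n :: real" "norm a * K"] by simp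
      then show ?thesis
        using mult_right_mono[of "norm a * K" "1 + (norm a * K) * 2 ^ n" "norm y ^ 2 ^ n"]
        by (simp add: mult_ac)
    qed
    finally show ?thesis .
  qed
  then show ?thesis by (rule le_if_two_powers_le[rotated 2]) auto
qed

lemma form_adjoint:
  assumes "is_a_adjoint a x x'"
  shows "star x * a * u = a * (x' * u)" "star x' * a * u = a * (x * u)"
  using assms is_a_adjoint_swap[OF star_a assms] by (simp_all add: is_a_adjoint_def mult.assoc)

text \<open>\<open>x' * x\<close> is its own \<open>a\<close>-adjoint, and \<open>\<phi>\<close>
  sends \<open>a * (x' * x)\<close> to the value defining \<open>sqnorm x\<close>. The bound is the
  same for all \<open>a\<close>-states, which keeps the suprema finite.\<close>

lemma sqnorm_le:
  assumes "is_a_adjoint a x x'"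
  shows "sqnorm x \<le> norm (x' * x)"
proof -
  note is_a_adjoint_mult[OF is_a_adjoint_swap[OF star_a assms] assms]
  from norm_state_self_adjoint_le[OF this] show ?thesis
    using complex_Re_le_cmod order_trans by (auto simp: sqnorm_def form_adjoint(1)[OF assms])
qed

text \<open>Cauchy-Schwarz is applied to each term and then to the finite sum, with each weight
  split into two factors \<open>sqrt (p j)\<close>.\<close>

lemma weighted_cauchy_schwarz:
  assumes p: "\<And>j. j \<in> I \<Longrightarrow> p j \<ge> 0"
  shows "(cmod (\<Sum>j\<in>I. of_real (p j) * \<phi> (star (u j) * a * v j)))\<^sup>2
    \<le> (\<Sum>j\<in>I. p j * sqnorm (u j)) * (\<Sum>j\<in>I. p j * sqnorm (v j))"
proof -
  let ?s = "\<lambda>w j. sqrt (p j * sqnorm (w j))"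
  have "cmod (\<Sum>j\<in>I. of_real (p j) * \<phi> (star (u j) * a * v j)) \<le> (\<Sum>j\<in>I. ?s u j * ?s v j)"
  proof (rule sum_norm_le)
    fix j assume j: "j \<in> I"
    have "?s u j * ?s v j = p j * (sqrt (sqnorm (u j)) * sqrt (sqnorm (v j)))"
      using p[OF j] by (simp add: real_sqrt_mult)
    then show "cmod (of_real (p j) * \<phi> (star (u j) * a * v j)) \<le> ?s u j * ?s v j"
      using p[OF j] norm_form_le by (simp add: norm_mult mult_left_mono)
  qed
  then have "(cmod (\<Sum>j\<in>I. of_real (p j) * \<phi> (star (u j) * a * v j)))\<^sup>2 \<le> (\<Sum>j\<in>I. ?s u j * ?s v j)\<^sup>2"
    by (simp add: power_mono)
  also have "\<dots> \<le> (\<Sum>j\<in>I. (?s u j)\<^sup>2) * (\<Sum>j\<in>I. (?s v j)\<^sup>2)"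
    by (rule Cauchy_Schwarz_ineq_sum)
  also have "\<dots> = (\<Sum>j\<in>I. p j * sqnorm (u j)) * (\<Sum>j\<in>I. p j * sqnorm (v j))"
    using p sqnorm_nonneg by (intro arg_cong2[of _ _ _ _ "(*)"] sum.cong) auto
  finally show ?thesis .
qed

text \<open>Buzano's inequality: the reflection \<open>\<xi> \<mapsto> 2 \<langle>e, \<xi>\<rangle> e - \<xi>\<close> in the unit vector \<open>e = (1, \<dots>, 1)\<close> of the
  weighted direct sum preserves the norm of \<open>(x\<^sub>j)\<close>.\<close>

lemma weighted_buzano:
  assumes p: "\<And>j. j \<in> I \<Longrightarrow> p j \<ge> 0" and sum_p: "(\<Sum>j\<in>I. p j) = 1"
    and adj: "\<And>j. j \<in> I \<Longrightarrow> is_a_adjoint a (x j) (x' j)"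
  defines "z \<equiv> \<phi> (a * (\<Sum>j\<in>I. p j *\<^sub>R x j))"
    and "R \<equiv> \<phi> (a * (\<Sum>j\<in>I. p j *\<^sub>R (x j)\<^sup>2))"
    and "P \<equiv> \<Sum>j\<in>I. p j * sqnorm (x j)"
    and "Q \<equiv> \<Sum>j\<in>I. p j * sqnorm (x' j)"
  shows "2 * (cmod z)\<^sup>2 \<le> cmod R + sqrt (P * Q)" and "cmod R \<le> sqrt (P * Q)"
proof -
  have z: "z = (\<Sum>j\<in>I. of_real (p j) * \<phi> (a * x j))"
    by (simp add: z_def sum_distrib_left \<phi>_sum lin scaleR_conv_of_real[where 'a = complex])
  have R: "R = (\<Sum>j\<in>I. of_real (p j) * \<phi> (star (x' j) * a * x j))"
    by (simp add: R_def sum_distrib_left \<phi>_sum lin form_adjoint(2)[OF adj] power2_eq_square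
        scaleR_conv_of_real[where 'a = complex] cong: sum.cong)
  show "cmod R \<le> sqrt (P * Q)"
    using weighted_cauchy_schwarz[of I p x' x] p unfolding R[symmetric] P_def Q_def
    by (intro real_le_rsqrt) (simp add: mult.commute)
  \<comment> \<open>The reflection of \<open>(x j)\<close>, where \<open>z\<close> is its inner
    product with the unit vector.\<close>
  define v where "v j = scaleC (2 * z) 1 - x j" for j
  have form_v: "\<phi> (star (x' j) * a * v j) = 2 * z * \<phi> (a * x j) - \<phi> (star (x' j) * a * x j)"
    if "j \<in> I" for j
    using form_adjoint(2)[OF adj[OF that], of 1]
    by (simp add: v_def right_diff_distrib lin mult_scaleC_right scale)
  \<comment> \<open>By adjointness \<open>(x' j)\<close> paired with the unit vector also gives
    \<open>z\<close>, whence the term \<open>2 * z * z\<close>.\<close>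
  have "(\<Sum>j\<in>I. of_real (p j) * \<phi> (star (x' j) * a * v j)) = 2 * z * z - R"
    using form_v by (simp add: R z right_diff_distrib sum_subtractf sum_distrib_left mult_ac cong: sum.cong)
  then have cs: "(cmod (2 * z * z - R))\<^sup>2 \<le> Q * (\<Sum>j\<in>I. p j * sqnorm (v j))"
    using weighted_cauchy_schwarz[of I p x' v] p by (simp add: Q_def)
  have "sqnorm (v j) = 4 * (cmod z)\<^sup>2 - 4 * Re (cnj z * \<phi> (a * x j)) + sqnorm (x j)" for j
  proof -
    have "\<phi> (star (x j) * a) = cnj (\<phi> (a * x j))"
      using form_cnj[of "x j" 1] by (simp add: star_one)
    then have "\<phi> (star (v j) * a * v j) = 4 * (z * cnj z) - 2 * (cnj z * \<phi> (a * x j))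
        - 2 * (z * cnj (\<phi> (a * x j))) + \<phi> (star (x j) * a * x j)"
      by (simp add: v_def star_simps algebra_simps mult_scaleC_left mult_scaleC_right lin scale \<phi>_a)
    then have "sqnorm (v j) = Re \<dots>" by (simp only: sqnorm_def)
    then show ?thesis
      unfolding cmod_power2 by (simp add: sqnorm_def power2_eq_square algebra_simps)
  qed
  moreover have "Re (cnj z * z) = (\<Sum>j\<in>I. p j * Re (cnj z * \<phi> (a * x j)))"
    by (subst (2) z) (simp add: sum_distrib_left right_diff_distrib[symmetric] algebra_simps sum.distrib)
  \<comment> \<open>As the weights sum to \<open>1\<close>, the two terms in \<open>z\<close>
    cancel: the reflection preserves \<open>P\<close>.\<close>
  ultimately have "(\<Sum>j\<in>I. p j * sqnorm (v j))
      = 4 * (cmod z)\<^sup>2 * (\<Sum>j\<in>I. p j) - 4 * Re (cnj z * z) + P"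
    by (simp only: P_def distrib_left right_diff_distrib sum.distrib sum_subtractf sum_distrib_left sum_distrib_right mult_ac)
  also have "\<dots> = P"
    unfolding cmod_power2 by (simp add: sum_p power2_eq_square)
  finally have "cmod (2 * z * z - R) \<le> sqrt (P * Q)"
    using cs by (intro real_le_rsqrt) (simp add: mult.commute)
  moreover have "cmod (2 * z * z) \<le> cmod (2 * z * z - R) + cmod R"
    by (metis diff_add_cancel norm_triangle_ineq)
  ultimately show "2 * (cmod z)\<^sup>2 \<le> cmod R + sqrt (P * Q)"
    by (simp add: norm_mult power2_eq_square)
qed

text \<open>The left side is the value of \<open>\<phi>\<close> at
  \<open>a * (x' * x + x * x')\<close>, bounded by Cauchy-Schwarz against \<open>1\<close>.\<close>

lemma sqnorm_add_le:
  assumes "is_a_adjoint a x x'"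
  shows "sqnorm x + sqnorm x' \<le> sqrt (sqnorm (x' * x + x * x'))"
proof -
  have "\<phi> (a * (x' * x + x * x')) = of_real (sqnorm x + sqnorm x')"
    using form_self[of x] form_self[of x'] by (simp add: form_adjoint[OF assms] distrib_left lin)
  then have "sqnorm x + sqnorm x' = cmod (\<phi> (a * (x' * x + x * x')))"
    by (simp only: norm_of_real) (simp add: sqnorm_nonneg)
  then show ?thesis using norm_state_le by simp
qed

end

section \<open>Suprema and infima over all \<open>a\<close>-states\<close>

lemma bdd_above_a_numerical_range:
  assumes "positive_element a" "is_a_adjoint a x x'"
  shows "bdd_above (cmod ` a_numerical_range a x)"
proof (rule bdd_aboveI2)
  fix z assume "z \<in> a_numerical_range a x"
  then obtain \<phi> where "\<phi> \<in> a_states a" and z: "z = \<phi> (a * x)"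
    by (auto simp: a_numerical_range_def)
  then interpret a_state a \<phi> using assms by unfold_locales
  show "cmod z \<le> sqrt (norm (x' * x))"
    using norm_state_le[of x] sqnorm_le[OF assms(2)] real_sqrt_le_mono order_trans unfolding z by blast
qed

lemma norm_le_a_numerical_radius:
  assumes "positive_element a" "is_a_adjoint a x x'" "\<phi> \<in> a_states a"
  shows "cmod (\<phi> (a * x)) \<le> a_numerical_radius a x"
  unfolding a_numerical_radius_def
  by (rule cSUP_upper[OF _ bdd_above_a_numerical_range[OF assms(1,2)]])
     (use assms(3) in \<open>auto simp: a_numerical_range_def\<close>)

lemma sqrt_sqnorm_le_a_norm:
  assumes a: "positive_element a" and adj: "is_a_adjoint a x x'" and \<phi>: "\<phi> \<in> a_states a"
  shows "sqrt (a_state.sqnorm a \<phi> x) \<le> a_norm a x"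
proof -
  have sq: "a_state.sqnorm a \<psi> x = Re (\<psi> (star x * a * x))"
      "a_state.sqnorm a \<psi> x \<le> norm (x' * x)" if "\<psi> \<in> a_states a" for \<psi>
  proof -
    interpret a_state a \<psi> using a that by unfold_locales
    show "sqnorm x = Re (\<psi> (star x * a * x))" "sqnorm x \<le> norm (x' * x)"
      using sqnorm_le[OF adj] by (simp_all add: sqnorm_def)
  qed
  have "bdd_above ((\<lambda>\<psi>. sqrt (Re (\<psi> (star x * a * x)))) ` a_states a)"
    by (rule bdd_aboveI2[where M = "sqrt (norm (x' * x))"]) (use sq in simp)
  then show ?thesis
    unfolding a_norm_def sq(1)[OF \<phi>] by (intro cSUP_upper \<phi>)
qed

lemma a_crawford_number_le:
  assumes "\<phi> \<in> a_states a"
  shows "a_crawford_number a x \<le> cmod (\<phi> (a * x))"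
  unfolding a_crawford_number_def
  by (rule cINF_lower) (use assms in \<open>auto simp: a_numerical_range_def intro!: bdd_belowI2[where m=0]\<close>)

text \<open>Over the reals the infimum of the empty set is unspecified, so an \<open>a\<close>-state
  has to exist.\<close>

lemma a_crawford_number_nonneg:
  assumes "a_states a \<noteq> {}"
  shows "0 \<le> a_crawford_number a x"
  unfolding a_crawford_number_def
  by (rule cINF_greatest) (use assms in \<open>auto simp: a_numerical_range_def\<close>)

text \<open>After \<open>(r + s) ^ 2 \<le> 2 * (r ^ 2 + s ^ 2)\<close> with
  \<open>s ^ 2 = P * Q\<close>, the share \<open>\<mu> / (1 + \<mu>)\<close> of \<open>r ^ 2\<close>
  is estimated by \<open>4 * r ^ 2 \<le> (P + Q) ^ 2\<close>, while \<open>4 * s ^ 2\<close> is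
  replaced exactly by \<open>(P + Q) ^ 2 - (P - Q) ^ 2\<close>.\<close>

lemma fourth_power_bound:
  fixes Z r P Q \<mu> :: real
  assumes Z: "2 * Z\<^sup>2 \<le> r + sqrt (P * Q)" and r: "0 \<le> r" "r \<le> sqrt (P * Q)"
    and "P * Q \<ge> 0" "\<mu> \<ge> 0"
  shows "Z ^ 4 \<le> 1 / (2 * (1 + \<mu>)) * r\<^sup>2 + (1 + 2 * \<mu>) / (8 * (1 + \<mu>)) * (P + Q)\<^sup>2 - 1 / 8 * (P - Q)\<^sup>2"
proof -
  define s where "s = sqrt (P * Q)"
  have s: "s\<^sup>2 = P * Q" "r \<le> s" using assms by (auto simp: s_def)
  have "(2 * Z\<^sup>2)\<^sup>2 \<le> (r + s)\<^sup>2"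
    using Z by (intro power_mono) (auto simp: s_def)
  then have "4 * Z ^ 4 \<le> (r + s)\<^sup>2" by (simp add: power_mult_distrib)
  also have "\<dots> \<le> 2 * (r\<^sup>2 + s\<^sup>2)"
    using zero_le_power2[of "r - s"] by (simp add: power2_eq_square algebra_simps)
  finally have "4 * Z ^ 4 \<le> 2 * (r\<^sup>2 + s\<^sup>2)" .
  then have "(2 * (1 + \<mu>)) * (4 * Z ^ 4) \<le> (2 * (1 + \<mu>)) * (2 * (r\<^sup>2 + s\<^sup>2))"
    using \<open>\<mu> \<ge> 0\<close> by (intro mult_left_mono) auto
  then have "8 * (1 + \<mu>) * Z ^ 4 \<le> 4 * (1 + \<mu>) * (r\<^sup>2 + s\<^sup>2)"
    by (simp only: mult_ac)
  also have "\<dots> \<le> 4 * r\<^sup>2 + \<mu> * (P + Q)\<^sup>2 + 4 * (1 + \<mu>) * s\<^sup>2"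
  proof -
    have "r\<^sup>2 \<le> s\<^sup>2" using r s by (intro power_mono) auto
    moreover have "4 * s\<^sup>2 \<le> (P + Q)\<^sup>2"
      unfolding s using zero_le_power2[of "P - Q"] by (simp add: power2_eq_square algebra_simps)
    ultimately have "\<mu> * (4 * r\<^sup>2) \<le> \<mu> * (P + Q)\<^sup>2"
      using \<open>\<mu> \<ge> 0\<close> by (intro mult_left_mono) auto
    then show ?thesis by (simp add: algebra_simps)
  qed
  also have "\<dots> = 4 * r\<^sup>2 + (1 + 2 * \<mu>) * (P + Q)\<^sup>2 - (1 + \<mu>) * (P - Q)\<^sup>2"
    unfolding s by (simp add: power2_eq_square algebra_simps)
  also have "\<dots> = 8 * (1 + \<mu>) * (1 / (2 * (1 + \<mu>)) * r\<^sup>2 + (1 + 2 * \<mu>) / (8 * (1 + \<mu>)) * (P + Q)\<^sup>2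
      - 1 / 8 * (P - Q)\<^sup>2)"
  \<comment> \<open>A general \<open>m\<close> keeps the denominator \<open>1 + \<mu>\<close> atomic
    during the field computation.\<close>
  proof -
    have "4 * A + c * B - m * D = 8 * m * (1 / (2 * m) * A + c / (8 * m) * B - 1 / 8 * D)"
      if "m \<noteq> 0" for m c A B D :: real
      using that by (simp add: field_simps)
    from this[of "1 + \<mu>"] show ?thesis using \<open>\<mu> \<ge> 0\<close> by simp
  qed
  finally show ?thesis
    using \<open>\<mu> \<ge> 0\<close> by simp
qed

theorem theorem3p9:
  fixes a :: "'a::unital_cstar_algebra"
    and k :: nat
    and x x' :: "nat \<Rightarrow> 'a"
    and p :: "nat \<Rightarrow> real"
    and \<mu> :: real
  assumes "positive_element a" and "a \<noteq> 0"
    and "k \<ge> 1"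
    and "\<And>j. j \<in> {1..k} \<Longrightarrow> x j \<in> a_adjointable a"
    and "\<And>j. j \<in> {1..k} \<Longrightarrow> is_a_adjoint a (x j) (x' j)"
    and "\<mu> \<ge> 0"
    and "\<And>j. j \<in> {1..k} \<Longrightarrow> p j \<ge> 0"
    and "(\<Sum>j=1..k. p j) = 1"
  shows "(a_numerical_radius a (\<Sum>j=1..k. p j *\<^sub>R x j)) ^ 4
    \<le> 1 / (2 * (1 + \<mu>)) * (a_numerical_radius a (\<Sum>j=1..k. p j *\<^sub>R (x j)\<^sup>2))\<^sup>2
      + (1 + 2 * \<mu>) / (8 * (1 + \<mu>)) * (\<Sum>j=1..k. p j * a_norm a (x' j * x j + x j * x' j))\<^sup>2
      - 1 / 8 * (a_crawford_number a (\<Sum>j=1..k. p j *\<^sub>R (x' j * x j - x j * x' j)))\<^sup>2"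
    (is "?v ^ 4 \<le> ?K")
proof -
  note a = assms(1) and adj = assms(5) and \<mu> = assms(6) and p = assms(7) and sum_p = assms(8)
  have ne: "a_states a \<noteq> {}" using assms(1,2) by (rule a_states_nonempty)
  have pointwise: "cmod (\<phi> (a * (\<Sum>j=1..k. p j *\<^sub>R x j))) ^ 4 \<le> ?K" if \<phi>: "\<phi> \<in> a_states a" for \<phi>
  proof -
    interpret a_state a \<phi> using a \<phi> by unfold_locales
    define P where "P = (\<Sum>j=1..k. p j * sqnorm (x j))"
    define Q where "Q = (\<Sum>j=1..k. p j * sqnorm (x' j))"
    define R where "R = cmod (\<phi> (a * (\<Sum>j=1..k. p j *\<^sub>R (x j)\<^sup>2)))"
    have PQ: "P \<ge> 0" "Q \<ge> 0"
      using p sqnorm_nonneg by (auto simp: P_def Q_def intro!: sum_nonneg)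
    have "cmod (\<phi> (a * (\<Sum>j=1..k. p j *\<^sub>R x j))) ^ 4
        \<le> 1 / (2 * (1 + \<mu>)) * R\<^sup>2 + (1 + 2 * \<mu>) / (8 * (1 + \<mu>)) * (P + Q)\<^sup>2 - 1 / 8 * (P - Q)\<^sup>2"
      using weighted_buzano[of "{1..k}" p x x', OF p sum_p adj] PQ \<mu>
      by (intro fourth_power_bound) (auto simp: P_def Q_def R_def)
    moreover have "R\<^sup>2 \<le> (a_numerical_radius a (\<Sum>j=1..k. p j *\<^sub>R (x j)\<^sup>2))\<^sup>2"
    proof -
      have "is_a_adjoint a (\<Sum>j=1..k. p j *\<^sub>R (x j)\<^sup>2) (\<Sum>j=1..k. p j *\<^sub>R (x' j)\<^sup>2)"
        unfolding power2_eq_square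
        by (intro is_a_adjoint_sum is_a_adjoint_scaleR is_a_adjoint_mult adj)
      from norm_le_a_numerical_radius[OF a this \<phi>] show ?thesis
        unfolding R_def by (intro power_mono) auto
    qed
    moreover have "(P + Q)\<^sup>2 \<le> (\<Sum>j=1..k. p j * a_norm a (x' j * x j + x j * x' j))\<^sup>2"
    proof (rule power_mono)
      have "sqnorm (x j) + sqnorm (x' j) \<le> a_norm a (x' j * x j + x j * x' j)" if j: "j \<in> {1..k}" for j
      proof -
        note adj' = is_a_adjoint_swap[OF star_a adj[OF j]]
        have "is_a_adjoint a (x' j * x j + x j * x' j) (x' j * x j + x j * x' j)"
          by (rule is_a_adjoint_add[OF is_a_adjoint_mult[OF adj' adj[OF j]] is_a_adjoint_mult[OF adj[OF j] adj']])
        from sqrt_sqnorm_le_a_norm[OF a this \<phi>] sqnorm_add_le[OF adj[OF j]] show ?thesis by simp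
      qed
      then show "P + Q \<le> (\<Sum>j=1..k. p j * a_norm a (x' j * x j + x j * x' j))"
        using p unfolding P_def Q_def sum.distrib[symmetric] distrib_left[symmetric]
        by (intro sum_mono mult_left_mono) auto
    qed (use PQ in simp)
    \<comment> \<open>The Crawford number enters with a minus sign, so an upper bound for it is
      needed; \<open>\<phi>\<close> takes the real value \<open>P - Q\<close> at the element in
      question.\<close>
    moreover have "(a_crawford_number a (\<Sum>j=1..k. p j *\<^sub>R (x' j * x j - x j * x' j)))\<^sup>2 \<le> (P - Q)\<^sup>2"
    proof -
      have "\<phi> (a * (p j *\<^sub>R (x' j * x j - x j * x' j))) = of_real (p j * sqnorm (x j) - p j * sqnorm (x' j))"
        if j: "j \<in> {1..k}" for j
        using form_self[of "x j"] form_self[of "x' j"]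
        by (simp add: form_adjoint[OF adj[OF j]] right_diff_distrib lin scaleR_conv_of_real[where 'a = complex])
      then have "\<phi> (a * (\<Sum>j=1..k. p j *\<^sub>R (x' j * x j - x j * x' j))) = of_real (P - Q)"
        unfolding P_def Q_def sum_subtractf[symmetric] of_real_sum sum_distrib_left \<phi>_sum
        by (intro sum.cong) auto
      then have "a_crawford_number a (\<Sum>j=1..k. p j *\<^sub>R (x' j * x j - x j * x' j)) \<le> \<bar>P - Q\<bar>"
        using a_crawford_number_le[OF \<phi>] by (metis norm_of_real)
      then show ?thesis
        using power_mono[OF _ a_crawford_number_nonneg[OF ne], of _ _ 2] by fastforce
    qed
    ultimately show ?thesis
      using \<mu> by (elim order_trans) (intro diff_mono add_mono mult_left_mono divide_nonneg_nonneg; simp)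
  qed
  \<comment> \<open>Not visible from the formula because of the subtracted term; the bound at any
    one state shows it.\<close>
  then have "0 \<le> ?K" using ne norm_ge_zero zero_le_power by (meson all_not_in_conv order_trans)
  \<comment> \<open>The supremum is over \<open>cmod z\<close>, not its fourth power, so the
    pointwise bound is brought to this form by a root.\<close>
  have "?v \<le> root 4 ?K"
    unfolding a_numerical_radius_def[of a "\<Sum>j=1..k. p j *\<^sub>R x j"]
  proof (rule cSUP_least)
    show "a_numerical_range a (\<Sum>j=1..k. p j *\<^sub>R x j) \<noteq> {}"
      using ne by (auto simp: a_numerical_range_def)
    fix z assume "z \<in> a_numerical_range a (\<Sum>j=1..k. p j *\<^sub>R x j)"
    then have "cmod z ^ 4 \<le> ?K" using pointwise by (auto simp: a_numerical_range_def)
    then have "root 4 (cmod z ^ 4) \<le> root 4 ?K" by (intro real_root_le_mono) auto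
    then show "cmod z \<le> root 4 ?K" by (subst (asm) real_root_power_cancel) auto
  qed
  moreover have "0 \<le> ?v"
  proof -
    obtain \<phi> where \<phi>: "\<phi> \<in> a_states a" using ne by blast
    have "is_a_adjoint a (\<Sum>j=1..k. p j *\<^sub>R x j) (\<Sum>j=1..k. p j *\<^sub>R x' j)"
      by (intro is_a_adjoint_sum is_a_adjoint_scaleR adj)
    from norm_le_a_numerical_radius[OF a this \<phi>] show ?thesis
      using norm_ge_zero order_trans by blast
  qed
  ultimately have "?v ^ 4 \<le> root 4 ?K ^ 4" by (intro power_mono)
  then show ?thesis using \<open>0 \<le> ?K\<close> by simp
qed

end
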